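(* Let $W$ be a BMS channel and let $R<I(W)$ be the rate of transmission. Consider an $\ell\times\ell$ polarizing kernel matrix $G$ with entries in $\{0,1\}$, let $w_0(G),\dots,w_{\ell-1}(G)$ be the Hamming weights of its rows, and define $$E_w(G)=\frac1\ell\sum_{i=0}^{\ell-1}\log_\ell w_i(G),\qquad V_w(G)=\frac1\ell\sum_{i=0}^{\ell-1}\big(\log_\ell w_i(G)-E_w(G)\big)^2 .$$ If polar codes with kernel $G$, of length $N=\ell^n$ and rate $R$, are used for transmission over $W$, then the probability of error under MAP decoding, $\mathbb{P}_e^{\mathrm{MAP}}(N,R)$, satisfies $$\log_\ell\big(-\log_2 \mathbb{P}_e^{\mathrm{MAP}}(N,R)\big)\le nE_w(G)+\sqrt{nV_w(G)}\,Q^{-1}\left(\frac{R}{I(W)}\right)+o(\sqrt n).$$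
   Context: $Q(t)=\int_t^\infty e^{-z^2/2}\,dz/\sqrt{2\pi}$ and $Q^{-1}$ is its inverse function. The $o(\sqrt n)$ term refers to $n\to\infty$ with $R$ fixed. **Channels.** A BMS (binary-input memoryless symmetric) channel $W$ has input alphabet $\{0,1\}$, output alphabet $\mathcal{Y}$, and transition probabilities $W(y\mid x)$, such that there is an involution $\pi$ of $\mathcal{Y}$ with $W(y\mid 1)=W(\pi(y)\mid 0)$ for all $y$. $I(W)\in[0,1]$ is the mutual information (in bits) between input and output of $W$ under the uniform input distribution. The Bhattacharyya parameter is $Z(W)=\sum_{y\in\mathcal{Y}}\sqrt{W(y\mid 0)W(y\mid 1)}$. **Polarizing matrix.** An $\ell\times\ell$ matrix $G$ with entries in $\{0,1\}$ is polarizing if it is invertible over $\mathrm{GF}(2)$ and none of its column permutations is upper triangular. **Channel splitting.** Given $G$ and a BMS channel $W$, for $0\le j\le \ell-1$ the BMS channel $W^j:\{0,1\}\to\mathcal{Y}^\ell\times\{0,1\}^j$ is defined by $$W^j(y_0^{\ell-1},u_0^{j-1}\mid u_j)=\frac{1}{2^{\ell-1}}\sum_{(u_{j+1},\dots,u_{\ell-1})\in\{0,1\}^{\ell-1-j}}\ \prod_{i=0}^{\ell-1}W\big(y_i\mid (u_0^{\ell-1}G)_i\big),$$ where $u_i^j=(u_i,\dots,u_j)$ and $u_0^{\ell-1}G$ is computed over $\mathrm{GF}(2)$. For $1\le i\le \ell^n$, if $b_1b_2\cdots b_n$ is the $\ell$-ary representation of $i-1$ ($b_1$ most significant), set $W_{\ell^n}^{(i)}=(((W^{b_1})^{b_2})^{\cdots})^{b_n}$.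 **Polar code.** Given $R$ and $N=\ell^n$, let $\mathcal{I}$ be a set of $NR$ indices $i\in\{1,\dots,N\}$ whose channels $W_{\ell^n}^{(i)}$ have the least values of the Bhattacharyya parameter. The polar code of length $N$ and rate $R$ is the binary linear code generated by the following rows of the $n$-fold Kronecker power $G^{\otimes n}$: for each $i\in\mathcal{I}$, the $j$th row, where the $\ell$-ary representation of $j-1$ (with $n$ digits) is the digit-reversal of that of $i-1$. **MAP error.** $\mathbb{P}_e^{\mathrm{MAP}}(N,R)$ is the average block error probability of the maximum a-posteriori decoder when a uniformly random codeword of this code is sent over $N$ independent uses of $W$.
   Formalization: It is assumed that I(W) < 1: for a noiseless channel (I(W) = 1) the MAP error probability is 0, so the left side is infinite and the claim fails; also R > 0, so that Q^{-1}(R/I(W)) is defined. *)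

theory Defs
  imports
    "HOL-Probability.Probability"
    "HOL-Library.Landau_Symbols"
    "HOL-Library.Z2"
    "Jordan_Normal_Form.Matrix"
    "Jordan_Normal_Form.VS_Connect"
begin

unbundle no vec_syntax

(* W x y is the transition probability W(y|x). Output alphabets are discrete; an alphabet that is
   smaller than the type 'y is represented by letting W vanish outside of it. *)
type_synonym 'y channel = "bit \<Rightarrow> 'y \<Rightarrow> real"

definition bms_channel :: "'y channel \<Rightarrow> bool" where
  "bms_channel W \<longleftrightarrow>
     (\<forall>x y. 0 \<le> W x y) \<and> (\<forall>x. (W x has_sum 1) UNIV) \<and>
     (\<exists>\<pi>. (\<forall>y. \<pi> (\<pi> y) = y) \<and> (\<forall>y. W 1 y = W 0 (\<pi> y)))"

definition uniform_joint :: "'y channel \<Rightarrow> (bit \<times> 'y) measure" where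
  "uniform_joint W = point_measure UNIV (\<lambda>(x, y). ennreal (W x y / 2))"

definition channel_information :: "'y channel \<Rightarrow> real" where
  "channel_information W =
     prob_space.mutual_information (uniform_joint W) 2 (count_space UNIV) (count_space UNIV) fst snd"

definition bhattacharyya :: "'y channel \<Rightarrow> real" where
  "bhattacharyya W = (\<Sum>\<^sub>\<infinity>y. sqrt (W 0 y * W 1 y))"

definition polarizing :: "nat \<Rightarrow> bit mat \<Rightarrow> bool" where
  "polarizing l G \<longleftrightarrow> G \<in> carrier_mat l l \<and> invertible_mat G \<and>
     (\<forall>p. p permutes {..<l} \<longrightarrow> \<not> upper_triangular (mat l l (\<lambda>(i, j). G $$ (i, p j))))"

(* Each splitting step changes the output alphabet from Y to Y^l x {0,1}^j. So that all iterated
   channels have one type, outputs are taken from the trees below: Raw y is an output of the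
   original channel, and Split ys us stands for the pair (ys, us). *)
datatype 'y symbol = Raw 'y | Split "'y symbol list" "bit list"

fun raw_channel :: "'y channel \<Rightarrow> 'y symbol channel" where
  "raw_channel W x (Raw y) = W x y"
| "raw_channel W x (Split ys us) = 0"

(* us = (u_0, ..., u_(j-1)) is part of the output, u = u_j is the input, and vs ranges over
   (u_(j+1), ..., u_(l-1)). The row vector u G is written as the transpose of G applied to u. *)
fun split_channel :: "bit mat \<Rightarrow> nat \<Rightarrow> 'y symbol channel \<Rightarrow> 'y symbol channel" where
  "split_channel G j W u (Raw y) = 0"
| "split_channel G j W u (Split ys us) =
     (if length ys = dim_row G \<and> length us = j then
        1 / 2 ^ (dim_row G - 1) *
        (\<Sum>vs | length vs = dim_row G - 1 - j.
           \<Prod>i<dim_row G. W ((transpose_mat G *\<^sub>v vec_of_list (us @ [u] @ vs)) $ i) (ys ! i))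
      else 0)"

(* The n base-l digits of k < l^n, most significant digit first. *)
definition digits :: "nat \<Rightarrow> nat \<Rightarrow> nat \<Rightarrow> nat list" where
  "digits l n k = map (\<lambda>m. k div l ^ (n - 1 - m) mod l) [0..<n]"

(* Indices i are counted from 0; the i-th channel is (((W^(b_1))^(b_2))^...)^(b_n). *)
definition polar_channel :: "bit mat \<Rightarrow> 'y channel \<Rightarrow> nat \<Rightarrow> nat \<Rightarrow> 'y symbol channel" where
  "polar_channel G W n i = fold (split_channel G) (digits (dim_row G) n i) (raw_channel W)"

definition kronecker :: "'a::semiring_1 mat \<Rightarrow> 'a mat \<Rightarrow> 'a mat" where
  "kronecker A B = mat (dim_row A * dim_row B) (dim_col A * dim_col B)
     (\<lambda>(i, j). A $$ (i div dim_row B, j div dim_col B) * B $$ (i mod dim_row B, j mod dim_col B))"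

fun kronecker_power :: "'a::semiring_1 mat \<Rightarrow> nat \<Rightarrow> 'a mat" where
  "kronecker_power A 0 = 1\<^sub>m 1"
| "kronecker_power A (Suc n) = kronecker A (kronecker_power A n)"

(* N R need not be an integer; rounding in either direction is allowed, and ties between
   Bhattacharyya parameters may be broken arbitrarily. *)
definition polar_index_set :: "bit mat \<Rightarrow> 'y channel \<Rightarrow> real \<Rightarrow> nat \<Rightarrow> nat set \<Rightarrow> bool" where
  "polar_index_set G W R n I \<longleftrightarrow>
     I \<subseteq> {..<dim_row G ^ n} \<and> \<bar>real (card I) - real (dim_row G ^ n) * R\<bar> < 1 \<and>
     (\<forall>i\<in>I. \<forall>k\<in>{..<dim_row G ^ n} - I.
        bhattacharyya (polar_channel G W n i) \<le> bhattacharyya (polar_channel G W n k))"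

definition polar_code :: "bit mat \<Rightarrow> nat \<Rightarrow> nat set \<Rightarrow> bit vec set" where
  "polar_code G n I =
     LinearCombinations.module.span class_ring (module_vec TYPE(bit) (dim_row G ^ n))
       {row (kronecker_power G n) j | i j. i \<in> I \<and> j < dim_row G ^ n \<and>
          digits (dim_row G) n j = rev (digits (dim_row G) n i)}"

definition likelihood :: "'y channel \<Rightarrow> bit vec \<Rightarrow> 'y list \<Rightarrow> real" where
  "likelihood W c ys = (\<Prod>i<dim_vec c. W (c $ i) (ys ! i))"

definition posterior :: "'y channel \<Rightarrow> bit vec set \<Rightarrow> 'y list \<Rightarrow> bit vec \<Rightarrow> real" where
  "posterior W C ys c =
     (1 / card C) * likelihood W c ys / (\<Sum>c'\<in>C. (1 / card C) * likelihood W c' ys)"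

definition map_decoder :: "'y channel \<Rightarrow> bit vec set \<Rightarrow> nat \<Rightarrow> ('y list \<Rightarrow> bit vec) \<Rightarrow> bool" where
  "map_decoder W C N dec \<longleftrightarrow>
     (\<forall>ys. length ys = N \<longrightarrow>
        dec ys \<in> C \<and> (\<forall>c\<in>C. posterior W C ys c \<le> posterior W C ys (dec ys)))"

definition block_error :: "'y channel \<Rightarrow> bit vec set \<Rightarrow> nat \<Rightarrow> ('y list \<Rightarrow> bit vec) \<Rightarrow> real" where
  "block_error W C N dec =
     (\<Sum>c\<in>C. (1 / card C) * (\<Sum>\<^sub>\<infinity>ys\<in>{ys. length ys = N \<and> dec ys \<noteq> c}. likelihood W c ys))"

definition hamming_weight :: "bit vec \<Rightarrow> nat" where
  "hamming_weight v = card {i. i < dim_vec v \<and> v $ i \<noteq> 0}"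

definition E_w :: "bit mat \<Rightarrow> real" where
  "E_w G = (1 / dim_row G) * (\<Sum>i<dim_row G. log (dim_row G) (hamming_weight (row G i)))"

definition V_w :: "bit mat \<Rightarrow> real" where
  "V_w G = (1 / dim_row G) *
     (\<Sum>i<dim_row G. (log (dim_row G) (hamming_weight (row G i)) - E_w G)\<^sup>2)"

definition Q :: "real \<Rightarrow> real" where
  "Q t = (LINT z:{t..}|lborel. exp (- z\<^sup>2 / 2) / sqrt (2 * pi))"

end

(* The row of the n-th Kronecker power with index digits b has Hamming weight prod_k w_(b_k), so the
   logarithms of the row weights of a random row are sums of i.i.d. terms and obey the central limit
   theorem. The chosen rows are asymptotically all reliable, and a fraction I(W) of all rows is
   reliable; polarization decides reliability from the first few digits, so that it is asymptotically
   independent of the row weight. Since the chosen rows are a fraction R / I(W) of the reliable ones,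
   one of them has a weight of at most the (1 - R / I(W))-quantile. This yields a codeword v of weight
   w; the error probability of every decoder on the pairs c, c + v is at least of order b^w for a b > 0.

   Polarization itself is obtained from the martingale property of the mutual information: its
   second moments increase and are bounded, so increments over t steps vanish in mean square, whereas
   for a polarizing kernel some digit, repeated t times, squares the Bhattacharyya parameter t times
   and thus forces a large increment at every channel that is neither good nor bad. *)
theory Submission
  imports Defs
begin

section \<open>Binary information functionals and sums over lists\<close>

text \<open>No speed of polarization is needed: the bound is a converse, so a row counts as reliable
  once its Bhattacharyya parameter is at most 1/4, and a single light row in the code already forces
  errors. The delicate point is independence, because reliability and row weight are functions of
  the same digits. A prefix of fixed length m, polarized up to a small error, is separated from the
  remaining k digits, and k grows while m stays fixed. The prefix shifts the logarithmic weight by a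
  bounded amount, which is lost at the scale sqrt k of the central limit theorem. The base b is
  \<open>overlap W\<close>, positive because the mutual information is below 1; after the double
  logarithm it costs only an additive constant. The argument works for every t above the value of
  the inverse of \<open>Q\<close>, from some n on that depends on t; letting t decrease to this
  value produces the o(sqrt n) term. Information is handled through the pointwise function
  \<open>pair_info\<close>, since its chain rule and its comparison with the Bhattacharyya parameter
  hold for each output separately and can be summed afterwards.\<close>

definition xlog :: "real \<Rightarrow> real" where
  "xlog x = x * log 2 x"

(* (a + b) (1 - h(a / (a + b))) with the binary entropy h in bits; the value is 0 at a = b = 0 because
   x / 0 = 0. *)
definition pair_info :: "real \<Rightarrow> real \<Rightarrow> real" where
  "pair_info a b = a * log 2 (2 * a / (a + b)) + b * log 2 (2 * b / (a + b))"

lemma xlog_0 [simp]: "xlog 0 = 0"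
  by (simp add: xlog_def)

lemma xlog_mult: "0 \<le> a \<Longrightarrow> 0 \<le> b \<Longrightarrow> xlog (a * b) = a * xlog b + b * xlog a"
  by (cases "a = 0 \<or> b = 0") (auto simp: xlog_def log_mult algebra_simps)

text \<open>The \<open>xlog\<close> terms are what telescopes when two siblings are merged into
  their parent; the mass \<open>a + b\<close> is the additive rest.\<close>

lemma pair_info_eq_xlog:
  assumes "0 \<le> a" "0 \<le> b"
  shows "pair_info a b = xlog a + xlog b - xlog (a + b) + (a + b)"
proof -
  have *: "x * log 2 (2 * x / (a + b)) = x + xlog x - x * log 2 (a + b)" if "x = a \<or> x = b" for x
  proof (cases "x = 0")
    case False
    then have "0 < x" "0 < a + b" using assms that by auto
    then show ?thesis by (simp add: xlog_def log_divide log_mult algebra_simps)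
  qed simp
  show ?thesis
    using *[of a] *[of b] by (simp add: pair_info_def xlog_def algebra_simps)
qed

lemma pair_info_scale:
  assumes "0 \<le> c"
  shows "pair_info (c * a) (c * b) = c * pair_info a b"
proof (cases "c = 0")
  case False
  have "2 * (c * x) / (c * a + c * b) = 2 * x / (a + b)" for x
    using False by (metis mult.left_commute mult_divide_mult_cancel_left distrib_left)
  then show ?thesis by (simp add: pair_info_def algebra_simps)
qed (simp add: pair_info_def)

lemma inverse_ln2_bounds: "1 \<le> 1 / ln (2::real)" "1 / ln (2::real) \<le> 2"
proof -
  have "ln (2::real) \<le> 1" using ln_le_minus_one[of 2] by simp
  then show "1 \<le> 1 / ln (2::real)" by (simp add: divide_simps)
  have "- ln (2::real) \<le> 1 / 2 - 1" using ln_le_minus_one[of "1/2"] by (simp add: ln_div)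
  then show "1 / ln (2::real) \<le> 2" by (simp add: divide_simps)
qed

lemma ln_lower: "0 < x \<Longrightarrow> 1 - 1 / x \<le> ln (x::real)"
  using ln_le_minus_one[of "1 / x"] by (simp add: ln_div)

lemma pair_info_nonneg:
  assumes "0 \<le> a" "0 \<le> b"
  shows "0 \<le> pair_info a b"
proof (cases "a + b = 0")
  case False
  have *: "x - (a + b) / 2 \<le> x * ln (2 * x / (a + b))" if "x = a \<or> x = b" for x
  proof (cases "x = 0")
    case False
    then have "0 < x" "0 < a + b" using assms that by auto
    then have "x * (1 - (a + b) / (2 * x)) \<le> x * ln (2 * x / (a + b))"
      using ln_lower[of "2 * x / (a + b)"] by (intro mult_left_mono) auto
    moreover have "x * (1 - (a + b) / (2 * x)) = x - (a + b) / 2"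
      using \<open>0 < x\<close> by (simp add: field_simps)
    ultimately show ?thesis by simp
  qed (use assms in auto)
  have "0 \<le> a * ln (2 * a / (a + b)) + b * ln (2 * b / (a + b))"
  proof -
    have "a - (a + b) / 2 + (b - (a + b) / 2) = 0" by (simp add: field_simps)
    with *[of a] *[of b] show ?thesis by linarith
  qed
  then have "0 \<le> (a * ln (2 * a / (a + b)) + b * ln (2 * b / (a + b))) / ln 2"
    by simp
  then show ?thesis by (simp add: pair_info_def log_def add_divide_distrib)
qed (use assms in \<open>simp add: pair_info_def add_nonneg_eq_0_iff\<close>)

text \<open>From \<open>ln x \<le> x - 1\<close> comes the bound (a - b)^2 / (a + b), and factoring
  a - b over square roots turns it into twice (sqrt a - sqrt b)^2. The other factor 2 bounds 1 / ln
  2. Summed over outputs, this keeps the Bhattacharyya parameter away from 1 whenever there is some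
  information.\<close>

lemma pair_info_le_hellinger:
  assumes "0 \<le> a" "0 \<le> b"
  shows "pair_info a b \<le> 4 * (a + b - 2 * sqrt (a * b))"
proof (cases "a + b = 0")
  case False
  then have s: "0 < a + b" using assms by auto
  have *: "x * ln (2 * x / (a + b)) \<le> x * (2 * x / (a + b) - 1)" if "x = a \<or> x = b" for x
  proof (cases "x = 0")
    case False
    then have "0 < x" using assms that by auto
    then show ?thesis using s ln_le_minus_one[of "2 * x / (a + b)"] by (intro mult_left_mono) auto
  qed auto
  have "a * ln (2 * a / (a + b)) + b * ln (2 * b / (a + b))
      \<le> a * (2 * a / (a + b) - 1) + b * (2 * b / (a + b) - 1)"
    using *[of a] *[of b] by simp
  also have "\<dots> = (a - b)\<^sup>2 / (a + b)"
  proof -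
    have "2 * a / (a + b) - 1 = (a - b) / (a + b)" "2 * b / (a + b) - 1 = - (a - b) / (a + b)"
      using s by (simp_all add: field_simps)
    then show ?thesis by (simp add: power2_eq_square algebra_simps flip: add_divide_distrib diff_divide_distrib)
  qed
  also have "\<dots> \<le> 2 * (sqrt a - sqrt b)\<^sup>2"
  proof -
    have "(a - b)\<^sup>2 = (sqrt a - sqrt b)\<^sup>2 * (sqrt a + sqrt b)\<^sup>2"
    proof -
      have "a - b = (sqrt a - sqrt b) * (sqrt a + sqrt b)"
        using assms by (simp add: algebra_simps)
      then show ?thesis by (simp add: power_mult_distrib)
    qed
    also have "\<dots> \<le> (sqrt a - sqrt b)\<^sup>2 * (2 * (a + b))"
    proof (rule mult_left_mono)
      have "0 \<le> (sqrt a - sqrt b)\<^sup>2" by simp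
      then show "(sqrt a + sqrt b)\<^sup>2 \<le> 2 * (a + b)"
        using assms by (simp add: power2_diff power2_sum)
    qed simp
    finally show ?thesis using s by (simp add: divide_simps algebra_simps)
  qed
  finally have le: "a * ln (2 * a / (a + b)) + b * ln (2 * b / (a + b)) \<le> 2 * (sqrt a - sqrt b)\<^sup>2" .
  have "pair_info a b = (a * ln (2 * a / (a + b)) + b * ln (2 * b / (a + b))) * (1 / ln 2)"
    by (simp add: pair_info_def log_def add_divide_distrib)
  also have "\<dots> \<le> 2 * (sqrt a - sqrt b)\<^sup>2 * (1 / ln 2)"
    using le by (intro mult_right_mono) auto
  also have "\<dots> \<le> 2 * (sqrt a - sqrt b)\<^sup>2 * 2"
    using inverse_ln2_bounds by (intro mult_left_mono) auto
  also have "\<dots> = 4 * (a + b - 2 * sqrt (a * b))"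
    using assms by (simp add: power2_diff real_sqrt_mult)
  finally show ?thesis .
qed (use assms in \<open>simp add: pair_info_def add_nonneg_eq_0_iff\<close>)

lemma pair_info_eq_loss:
  assumes "0 \<le> a" "0 \<le> b" "0 < a + b"
  shows "a + b - pair_info a b = (a * ln ((a + b) / a) + b * ln ((a + b) / b)) * (1 / ln 2)"
proof -
  have *: "x - x * log 2 (2 * x / (a + b)) = x * ln ((a + b) / x) * (1 / ln 2)"
    if "x = a \<or> x = b" for x
  proof (cases "x = 0")
    case False
    then have "0 < x" using assms that by auto
    then show ?thesis using assms(3)
      by (simp add: log_def ln_div ln_mult field_simps)
  qed auto
  show ?thesis using *[of a] *[of b] unfolding pair_info_def by (simp add: algebra_simps)
qed

text \<open>Square roots are taken before \<open>ln x \<le> x - 1\<close> is applied, which gives 2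
  r (sqrt a + sqrt b - r) with r = sqrt (a + b). As r \<le> sqrt a + sqrt b, the factor 2 r may be
  raised to sqrt a + sqrt b + r, and a difference of squares remains.\<close>

lemma pair_info_loss_le:
  assumes "0 \<le> a" "0 \<le> b"
  shows "a + b - pair_info a b \<le> 4 * sqrt (a * b)"
proof (cases "a + b = 0")
  case False
  then have s: "0 < a + b" using assms by auto
  define r where "r = sqrt (a + b)"
  have r: "0 < r" "r * r = a + b" using s by (auto simp: r_def)
  have *: "x * ln ((a + b) / x) \<le> 2 * (r * sqrt x - x)" if "x = a \<or> x = b" for x
  proof (cases "x = 0")
    case False
    then have x: "0 < x" using assms that by auto
    have "ln ((a + b) / x) = 2 * ln (r / sqrt x)"
      using x s by (simp add: ln_div ln_sqrt r_def)
    also have "\<dots> \<le> 2 * (r / sqrt x - 1)"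
      using ln_le_minus_one[of "r / sqrt x"] x r by simp
    finally have "x * ln ((a + b) / x) \<le> x * (2 * (r / sqrt x - 1))"
      using x by (intro mult_left_mono) auto
    also have "\<dots> = 2 * (r * sqrt x - x)"
    proof -
      have "x * (r / sqrt x) = r * sqrt x"
        using x by (metis mult.commute real_div_sqrt times_divide_eq_right less_imp_le)
      moreover have "x * (2 * (r / sqrt x - 1)) = 2 * (x * (r / sqrt x) - x)"
        by (simp only: algebra_simps)
      ultimately show ?thesis by simp
    qed
    finally show ?thesis .
  qed auto
  have "a * ln ((a + b) / a) + b * ln ((a + b) / b) \<le> 2 * r * (sqrt a + sqrt b - r)"
    using *[of a] *[of b] r by (simp add: algebra_simps)
  also have "\<dots> \<le> 2 * sqrt (a * b)"
  proof -
    have le: "r \<le> sqrt a + sqrt b"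
      unfolding r_def by (intro real_le_lsqrt) (use assms in \<open>auto simp: power2_sum\<close>)
    have "2 * r * (sqrt a + sqrt b - r) \<le> (sqrt a + sqrt b + r) * (sqrt a + sqrt b - r)"
      using le by (intro mult_right_mono) auto
    also have "\<dots> = (sqrt a + sqrt b)\<^sup>2 - r * r"
      by (simp add: power2_eq_square algebra_simps)
    also have "\<dots> = 2 * sqrt (a * b)"
      using assms by (simp add: r power2_sum real_sqrt_mult)
    finally show ?thesis .
  qed
  finally have le: "a * ln ((a + b) / a) + b * ln ((a + b) / b) \<le> 2 * sqrt (a * b)" .
  have "a + b - pair_info a b \<le> 2 * sqrt (a * b) * (1 / ln 2)"
    unfolding pair_info_eq_loss[OF assms s] using le by (intro mult_right_mono) auto
  also have "\<dots> \<le> 2 * sqrt (a * b) * 2"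
    using inverse_ln2_bounds assms by (intro mult_left_mono) auto
  finally show ?thesis by simp
qed (use assms in \<open>simp add: pair_info_def add_nonneg_eq_0_iff\<close>)

text \<open>A square-root bound on the Bhattacharyya parameter, linearized by the inequality of
  arithmetic and geometric means with a free weight t: in this form it can be summed over outputs
  term by term and t chosen afterwards. The loss enters because it dominates
  \<open>2 * (a * b / (a + b))\<close>.\<close>

lemma sqrt_le_pair_info_loss:
  assumes "0 \<le> a" "0 \<le> b" "0 < t"
  shows "sqrt (a * b) \<le> t * (a + b) + (a + b - pair_info a b) / (8 * t)"
proof (cases "a + b = 0")
  case False
  then have s: "0 < a + b" using assms by auto
  have *: "a * b / (a + b) \<le> x * ln ((a + b) / x)" if "x = a \<or> x = b" for x
  proof (cases "x = 0")
    case False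
    then have x: "0 < x" using assms that by auto
    have "x * (1 - x / (a + b)) \<le> x * ln ((a + b) / x)"
      using ln_lower[of "(a + b) / x"] x s by (intro mult_left_mono) auto
    moreover have "x * (1 - x / (a + b)) = a * b / (a + b)"
      using that s by (auto simp: field_simps)
    ultimately show ?thesis by simp
  qed (use that in auto)
  have nn: "0 \<le> a * b / (a + b)" using assms by simp
  have "2 * (a * b / (a + b)) \<le> (a * ln ((a + b) / a) + b * ln ((a + b) / b))"
    using *[of a] *[of b] by simp
  also have "\<dots> * 1 \<le> \<dots> * (1 / ln 2)"
    using inverse_ln2_bounds *[of a] *[of b] nn by (intro mult_left_mono) linarith+
  finally have loss: "2 * (a * b / (a + b)) \<le> a + b - pair_info a b"
    using pair_info_eq_loss[OF assms(1,2) s] by simp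
  have "sqrt (a * b) = sqrt (t * (a + b) * (a * b / (t * (a + b))))"
    using s assms by simp
  also have "\<dots> = sqrt (2 * t * (a + b)) * sqrt (a * b / (2 * t * (a + b)))"
    using s assms by (simp flip: real_sqrt_mult)
  also have "\<dots> \<le> (2 * t * (a + b) + a * b / (2 * t * (a + b))) / 2"
    using arith_geo_mean_sqrt[of "2 * t * (a + b)" "a * b / (2 * t * (a + b))"] s assms
    by (simp only: flip: real_sqrt_mult) simp
  also have "\<dots> = t * (a + b) + 2 * (a * b / (a + b)) / (8 * t)"
  proof -
    have "(2 * t * r + p / (2 * t * r)) / 2 = t * r + 2 * (p / r) / (8 * t)" if "0 < r" for r p :: real
      using assms that by (simp add: field_simps)
    from this[OF s] show ?thesis .
  qed
  also have "\<dots> \<le> t * (a + b) + (a + b - pair_info a b) / (8 * t)"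
    using loss assms by (intro add_left_mono divide_right_mono) auto
  finally show ?thesis .
qed (use assms in \<open>simp add: pair_info_def add_nonneg_eq_0_iff\<close>)

lemma pair_info_le_sum:
  assumes "0 \<le> a" "0 \<le> b"
  shows "pair_info a b \<le> a + b"
proof (cases "a + b = 0")
  case False
  then have s: "0 < a + b" using assms by auto
  have "0 \<le> x * ln ((a + b) / x)" if "x = a \<or> x = b" for x
    using that assms by (cases "x = 0") (auto intro!: mult_nonneg_nonneg ln_ge_zero simp: divide_simps)
  then have "0 \<le> (a * ln ((a + b) / a) + b * ln ((a + b) / b)) * (1 / ln 2)" by simp
  then show ?thesis using pair_info_eq_loss[OF assms s] by simp
qed (use assms in \<open>simp add: pair_info_def add_nonneg_eq_0_iff\<close>)

section \<open>Sums over product sets and over words of fixed length\<close>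

lemma has_sum_times_nonneg:
  fixes f :: "'a \<Rightarrow> real" and g :: "'b \<Rightarrow> real"
  assumes f: "(f has_sum a) A" and g: "(g has_sum b) B"
    and nn: "\<And>x. x \<in> A \<Longrightarrow> 0 \<le> f x" "\<And>y. y \<in> B \<Longrightarrow> 0 \<le> g y"
  shows "((\<lambda>(x, y). f x * g y) has_sum a * b) (A \<times> B)"
proof (rule has_sum_SigmaI)
  show "((\<lambda>y. case (x, y) of (x, y) \<Rightarrow> f x * g y) has_sum f x * b) B" if "x \<in> A" for x
    using has_sum_cmult_right[OF g, of "f x"] by simp
  show "((\<lambda>x. f x * b) has_sum a * b) A"
    by (rule has_sum_cmult_left[OF f])
  show "(\<lambda>(x, y). f x * g y) summable_on A \<times> B"
  proof (rule summable_on_SigmaI)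
    show "((\<lambda>y. case (x, y) of (x, y) \<Rightarrow> f x * g y) has_sum f x * b) B" if "x \<in> A" for x
      using has_sum_cmult_right[OF g, of "f x"] by simp
    show "(\<lambda>x. f x * b) summable_on A"
      using has_sum_cmult_left[OF f, of b] has_sum_imp_summable by blast
  qed (use nn in auto)
qed

lemma bij_betw_Cons_lists:
  "bij_betw (\<lambda>(y, ys). y # ys) (UNIV \<times> {ys. length ys = n}) {ys. length ys = Suc n}"
  by (rule bij_betw_byWitness[where f' = "\<lambda>ys. (hd ys, tl ys)"]) (auto simp: length_Suc_conv)

lemma has_sum_lists_Suc:
  fixes F :: "'a list \<Rightarrow> real"
  assumes "((\<lambda>(y, ys). F (y # ys)) has_sum s) (UNIV \<times> {ys. length ys = n})"
  shows "(F has_sum s) {ys. length ys = Suc n}"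
  using has_sum_reindex_bij_betw[OF bij_betw_Cons_lists[of n], where f = F and S = s] assms
  by (simp add: case_prod_unfold)

text \<open>Memorylessness in the form used throughout. The factors may differ by position, so that
  positions with averaged, fixed or minimized inputs can be mixed in one product.\<close>

lemma has_sum_prod_lists:
  fixes g :: "nat \<Rightarrow> 'a \<Rightarrow> real"
  assumes "\<And>i. i < n \<Longrightarrow> (g i has_sum s i) UNIV" "\<And>i y. i < n \<Longrightarrow> 0 \<le> g i y"
  shows "((\<lambda>ys. \<Prod>i<n. g i (ys ! i)) has_sum (\<Prod>i<n. s i)) {ys. length ys = n}"
  using assms
proof (induction n arbitrary: g s)
  case 0
  have "{ys::'a list. length ys = 0} = {[]}" by auto
  then show ?case by (auto intro: has_sum_finiteI)
next
  case (Suc n)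
  have "((\<lambda>ys. \<Prod>i<n. g (Suc i) (ys ! i)) has_sum (\<Prod>i<n. s (Suc i))) {ys. length ys = n}"
    by (rule Suc.IH) (use Suc.prems in auto)
  then have "((\<lambda>(y, ys). g 0 y * (\<Prod>i<n. g (Suc i) (ys ! i))) has_sum s 0 * (\<Prod>i<n. s (Suc i)))
      (UNIV \<times> {ys. length ys = n})"
    using Suc.prems by (intro has_sum_times_nonneg) (auto intro!: prod_nonneg)
  then show ?case
    by (intro has_sum_lists_Suc) (simp add: prod.lessThan_Suc_shift case_prod_unfold del: prod.lessThan_Suc)
qed

section \<open>Information and Bhattacharyya parameter of a channel\<close>

lemma UNIV_bit: "(UNIV :: bit set) = {0, 1}"
  by (auto intro: bit.exhaust)

lemma finite_UNIV_bit: "finite (UNIV :: bit set)" and card_UNIV_bit: "card (UNIV :: bit set) = 2"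
  by (simp_all add: UNIV_bit)

lemma finite_bit_lists [simp]: "finite {us :: bit list. length us = n}"
  using finite_lists_length_eq[OF finite_UNIV_bit, of n] by simp

lemma card_bit_lists [simp]: "card {us :: bit list. length us = n} = 2 ^ n"
  using card_lists_length_eq[OF finite_UNIV_bit, of n] card_UNIV_bit by simp

section \<open>Weights on bit words and the chain rule for information\<close>

lemma sum_bit_lists_Cons:
  fixes F :: "bit list \<Rightarrow> real"
  shows "(\<Sum>us | length us = Suc n. F us) = (\<Sum>us | length us = n. F (0 # us) + F (1 # us))"
proof -
  have eq: "{us. length us = Suc n} = (#) 0 ` {us. length us = n} \<union> (#) 1 ` {us :: bit list. length us = n}"
    by (auto simp: length_Suc_conv image_iff)
  show ?thesis
    unfolding eq
    by (subst sum.union_disjoint) (auto simp: sum.reindex inj_on_def sum.distrib)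
qed

lemma sum_bit_lists_snoc:
  fixes F :: "bit list \<Rightarrow> real"
  shows "(\<Sum>us | length us = Suc n. F us) = (\<Sum>us | length us = n. F (us @ [0]) + F (us @ [1]))"
proof -
  have eq: "{us. length us = Suc n}
      = (\<lambda>us. us @ [0]) ` {us. length us = n} \<union> (\<lambda>us. us @ [1]) ` {us :: bit list. length us = n}"
    by (auto simp: length_Suc_conv_rev image_iff)
  show ?thesis
    unfolding eq
    by (subst sum.union_disjoint) (auto simp: sum.reindex inj_on_def sum.distrib)
qed

(* Only meaningful for length v <= n, since n - length v is truncated. *)
definition prefix_sum :: "nat \<Rightarrow> (bit list \<Rightarrow> real) \<Rightarrow> bit list \<Rightarrow> real" where
  "prefix_sum n p v = (\<Sum>vs | length vs = n - length v. p (v @ vs))"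

lemma prefix_sum_nonneg: "(\<And>v. 0 \<le> p v) \<Longrightarrow> 0 \<le> prefix_sum n p v"
  by (simp add: prefix_sum_def sum_nonneg)

lemma prefix_sum_full: "length v = n \<Longrightarrow> prefix_sum n p v = p v"
  by (simp add: prefix_sum_def)

lemma prefix_sum_split:
  assumes "length v < n"
  shows "prefix_sum n p v = prefix_sum n p (v @ [0]) + prefix_sum n p (v @ [1])"
proof -
  have "n - length v = Suc (n - Suc (length v))" using assms by simp
  then show ?thesis
    by (simp add: prefix_sum_def sum_bit_lists_Cons sum.distrib)
qed

lemma sum_prefix_sum:
  "m \<le> n \<Longrightarrow> (\<Sum>v | length v = m. prefix_sum n p v) = (\<Sum>v | length v = n. p v)"
proof (induction m)
  case (Suc m)
  have "(\<Sum>v | length v = Suc m. prefix_sum n p v) = (\<Sum>v | length v = m. prefix_sum n p v)"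
    unfolding sum_bit_lists_snoc
    by (rule sum.cong) (use Suc.prems in \<open>auto intro: prefix_sum_split[symmetric]\<close>)
  then show ?case using Suc by simp
qed (simp add: prefix_sum_def)

text \<open>Chain rule for unnormalized weights: by \<open>pair_info_eq_xlog\<close>, level j
  contributes the \<open>xlog\<close> sum of level j + 1 minus that of level j, plus the total mass,
  which is the same on every level.\<close>

lemma prefix_information_chain:
  assumes p: "\<And>v. 0 \<le> p v"
  shows "(\<Sum>j<n. \<Sum>us | length us = j. pair_info (prefix_sum n p (us @ [0])) (prefix_sum n p (us @ [1])))
    = (\<Sum>v | length v = n. xlog (p v)) - xlog (\<Sum>v | length v = n. p v) + n * (\<Sum>v | length v = n. p v)"
proof -
  define H where "H m = (\<Sum>v | length v = m. xlog (prefix_sum n p v))" for m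
  have step: "(\<Sum>us | length us = j. pair_info (prefix_sum n p (us @ [0])) (prefix_sum n p (us @ [1])))
      = H (Suc j) - H j + (\<Sum>v | length v = n. p v)" if "j < n" for j
  proof -
    have "pair_info (prefix_sum n p (us @ [0])) (prefix_sum n p (us @ [1]))
        = xlog (prefix_sum n p (us @ [0])) + xlog (prefix_sum n p (us @ [1]))
          - xlog (prefix_sum n p us) + prefix_sum n p us" if "length us = j" for us
      using prefix_sum_split[of us n p] that \<open>j < n\<close>
      by (simp add: pair_info_eq_xlog prefix_sum_nonneg p)
    then have "(\<Sum>us | length us = j. pair_info (prefix_sum n p (us @ [0])) (prefix_sum n p (us @ [1])))
      = (\<Sum>us | length us = j. xlog (prefix_sum n p (us @ [0])) + xlog (prefix_sum n p (us @ [1]))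
          - xlog (prefix_sum n p us) + prefix_sum n p us)"
      by (intro sum.cong) auto
    also have "\<dots> = H (Suc j) - H j + (\<Sum>v | length v = n. p v)"
      using sum_prefix_sum[of j n p] that
      by (simp add: H_def sum_bit_lists_snoc sum.distrib sum_subtractf)
    finally show ?thesis .
  qed
  have "H n = (\<Sum>v | length v = n. xlog (p v))"
    unfolding H_def by (intro sum.cong) (auto simp: prefix_sum_full)
  moreover have "H 0 = xlog (\<Sum>v | length v = n. p v)"
    by (simp add: H_def prefix_sum_def)
  moreover have "(\<Sum>j<n. H (Suc j) - H j) = H n - H 0"
    by (rule sum_lessThan_telescope)
  ultimately show ?thesis using step by (simp add: sum.distrib)
qed

lemma sum_bit_lists_prod:
  fixes a :: "nat \<Rightarrow> bit \<Rightarrow> real"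
  shows "(\<Sum>x | length x = n. \<Prod>i<n. a i (x ! i)) = (\<Prod>i<n. a i 0 + a i 1)"
proof (induction n arbitrary: a)
  case (Suc n)
  show ?case
    unfolding sum_bit_lists_Cons prod.lessThan_Suc_shift nth_Cons_0 nth_Cons_Suc
    using Suc[of "\<lambda>i. a (Suc i)"]
    by (simp add: o_def flip: distrib_right sum_distrib_left)
qed simp

text \<open>\<open>xlog\<close> obeys the product rule of a derivation (\<open>xlog_mult\<close>),
  so on a product it acts on one factor at a time.\<close>

lemma xlog_prod:
  fixes b :: "nat \<Rightarrow> real"
  assumes "\<And>i. 0 \<le> b i"
  shows "xlog (\<Prod>i<n. b i) = (\<Sum>i<n. \<Prod>k<n. if k = i then xlog (b k) else b k)"
proof (induction n)
  case (Suc n)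
  have "(\<Sum>i<n. \<Prod>k<Suc n. if k = i then xlog (b k) else b k)
      = (\<Sum>i<n. \<Prod>k<n. if k = i then xlog (b k) else b k) * b n"
    unfolding sum_distrib_right by (rule sum.cong) auto
  moreover have "(\<Prod>k<Suc n. if k = n then xlog (b k) else b k) = (\<Prod>k<n. b k) * xlog (b n)"
    by simp
  ultimately show ?case
    using Suc assms by (simp add: xlog_mult prod_nonneg)
qed (simp add: xlog_def)

(* Summed over j, the information of the split channels telescopes to the left-hand side
   (prefix_information_chain), for each output word separately; so no entropy of a possibly infinite
   output alphabet ever occurs. *)
lemma product_information:
  fixes a :: "nat \<Rightarrow> bit \<Rightarrow> real"
  assumes a: "\<And>i x. 0 \<le> a i x"
  shows "(\<Sum>x | length x = n. xlog (\<Prod>i<n. a i (x ! i)))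
      - xlog (\<Prod>i<n. a i 0 + a i 1) + n * (\<Prod>i<n. a i 0 + a i 1)
    = (\<Sum>i<n. \<Prod>k<n. if k = i then pair_info (a k 0) (a k 1) else a k 0 + a k 1)"
proof -
  have split: "(\<Prod>k<n. if k = i then f k else g k) = f i * (\<Prod>k\<in>{..<n} - {i}. g k)"
    if "i < n" for f g :: "nat \<Rightarrow> real" and i
    using that by (subst prod.remove[of _ i]) (auto intro!: prod.cong)
  have 1: "(\<Sum>x | length x = n. xlog (\<Prod>i<n. a i (x ! i)))
      = (\<Sum>i<n. \<Prod>k<n. if k = i then xlog (a k 0) + xlog (a k 1) else a k 0 + a k 1)"
  proof -
    have "(\<Sum>x | length x = n. xlog (\<Prod>i<n. a i (x ! i)))
       = (\<Sum>x | length x = n. \<Sum>i<n. \<Prod>k<n. (\<lambda>k b. if k = i then xlog (a k b) else a k b) k (x ! k))"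
      by (rule sum.cong) (auto simp: xlog_prod a)
    also have "\<dots> = (\<Sum>i<n. \<Sum>x | length x = n. \<Prod>k<n. (\<lambda>k b. if k = i then xlog (a k b) else a k b) k (x ! k))"
      by (rule sum.swap)
    also have "\<dots> = (\<Sum>i<n. \<Prod>k<n. if k = i then xlog (a k 0) + xlog (a k 1) else a k 0 + a k 1)"
    proof (rule sum.cong)
      fix i
      show "(\<Sum>x | length x = n. \<Prod>k<n. (\<lambda>k b. if k = i then xlog (a k b) else a k b) k (x ! k))
          = (\<Prod>k<n. if k = i then xlog (a k 0) + xlog (a k 1) else a k 0 + a k 1)"
      proof (rule trans[OF sum_bit_lists_prod])
        show "(\<Prod>k<n. (if k = i then xlog (a k 0) else a k 0) + (if k = i then xlog (a k 1) else a k 1))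
          = (\<Prod>k<n. if k = i then xlog (a k 0) + xlog (a k 1) else a k 0 + a k 1)"
          by (rule prod.cong) auto
      qed
    qed simp
    finally show ?thesis .
  qed
  have 2: "xlog (\<Prod>i<n. a i 0 + a i 1)
      = (\<Sum>i<n. \<Prod>k<n. if k = i then xlog (a k 0 + a k 1) else a k 0 + a k 1)"
    by (rule xlog_prod) (simp add: a)
  have 3: "n * (\<Prod>i<n. a i 0 + a i 1)
      = (\<Sum>i<n. \<Prod>k<n. if k = i then a k 0 + a k 1 else a k 0 + a k 1)"
    by simp
  show ?thesis
    unfolding 1 2 3 sum.distrib[symmetric] sum_subtractf[symmetric]
    by (rule sum.cong) (auto simp only: split lessThan_iff pair_info_eq_xlog a algebra_simps)
qed

definition channel :: "'y channel \<Rightarrow> bool" where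
  "channel W \<longleftrightarrow> (\<forall>x y. 0 \<le> W x y) \<and> (\<forall>x. (W x has_sum 1) UNIV)"

text \<open>Mutual information for the uniform input, as a plain sum, so that no measure on the
  trees \<open>'y symbol\<close> is needed. The factor 1/2 is the input probability.
  \<open>channel_information_eq_info\<close> connects it with the measure-theoretic notion.\<close>

definition info :: "'y channel \<Rightarrow> real" where
  "info W = (\<Sum>\<^sub>\<infinity>y. pair_info (W 0 y) (W 1 y)) / 2"

lemma channel_nonneg [simp]: "channel W \<Longrightarrow> 0 \<le> W x y"
  and channel_has_sum: "channel W \<Longrightarrow> (W x has_sum 1) UNIV"
  by (auto simp: channel_def)

lemma channel_has_sum_add:
  assumes "channel W"
  shows "((\<lambda>y. W 0 y + W 1 y) has_sum 2) UNIV"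
  using has_sum_add[OF channel_has_sum[OF assms, of 0] channel_has_sum[OF assms, of 1]] by simp

lemma has_sum_pair_info:
  assumes "channel W"
  shows "((\<lambda>y. pair_info (W 0 y) (W 1 y)) has_sum (2 * info W)) UNIV"
proof -
  have "(\<lambda>y. pair_info (W 0 y) (W 1 y)) summable_on UNIV"
    by (rule summable_on_comparison_test[OF has_sum_imp_summable[OF channel_has_sum_add[OF assms]]])
      (use assms in \<open>auto intro: pair_info_le_sum pair_info_nonneg\<close>)
  then show ?thesis by (simp add: info_def)
qed

lemma has_sum_bhattacharyya:
  assumes "channel W"
  shows "((\<lambda>y. sqrt (W 0 y * W 1 y)) has_sum bhattacharyya W) UNIV"
proof -
  have "(\<lambda>y. sqrt (W 0 y * W 1 y)) summable_on UNIV"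
  proof (rule summable_on_comparison_test[OF has_sum_imp_summable[OF channel_has_sum_add[OF assms]]])
    show "sqrt (W 0 y * W 1 y) \<le> W 0 y + W 1 y" for y
    proof -
      have "0 \<le> W 0 y" "0 \<le> W 1 y" using assms by simp_all
      moreover from this have "(W 0 y + W 1 y) / 2 \<le> W 0 y + W 1 y" by simp
      ultimately show ?thesis using arith_geo_mean_sqrt[of "W 0 y" "W 1 y"] order_trans by blast
    qed
  qed (use assms in auto)
  then show ?thesis by (simp add: bhattacharyya_def)
qed

lemma info_nonneg:
  assumes "channel W"
  shows "0 \<le> info W"
  using has_sum_nonneg[OF has_sum_pair_info[OF assms]] assms by (simp add: pair_info_nonneg)

lemma info_le_1:
  assumes "channel W"
  shows "info W \<le> 1"
  using has_sum_mono[OF has_sum_pair_info[OF assms] channel_has_sum_add[OF assms]] assms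
  by (simp add: pair_info_le_sum)

lemma bhattacharyya_nonneg:
  assumes "channel W"
  shows "0 \<le> bhattacharyya W"
  using has_sum_nonneg[OF has_sum_bhattacharyya[OF assms]] assms by simp

lemma info_le_bhattacharyya:
  assumes "channel W"
  shows "info W \<le> 4 * (1 - bhattacharyya W)"
proof -
  have "((\<lambda>y. 4 * (W 0 y + W 1 y + - 2 * sqrt (W 0 y * W 1 y))) has_sum (4 * (2 + - 2 * bhattacharyya W))) UNIV"
    by (intro has_sum_cmult_right has_sum_add[OF channel_has_sum_add] has_sum_bhattacharyya assms)
  from has_sum_mono[OF has_sum_pair_info[OF assms] this] show ?thesis
    using assms pair_info_le_hellinger by fastforce
qed

lemma bhattacharyya_le_1:
  assumes "channel W"
  shows "bhattacharyya W \<le> 1"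
  using info_le_bhattacharyya[OF assms] info_nonneg[OF assms] by simp

lemma info_ge_bhattacharyya:
  assumes "channel W"
  shows "1 - info W \<le> 2 * bhattacharyya W"
proof -
  have "((\<lambda>y. W 0 y + W 1 y + - 1 * pair_info (W 0 y) (W 1 y)) has_sum (2 + -1 * (2 * info W))) UNIV"
    by (intro has_sum_cmult_right has_sum_add[OF channel_has_sum_add] has_sum_pair_info assms)
  from has_sum_mono[OF this has_sum_cmult_right[OF has_sum_bhattacharyya[OF assms], of 4]] show ?thesis
    using assms pair_info_loss_le by fastforce
qed

lemma bhattacharyya_le_info:
  assumes "channel W" "0 < t"
  shows "bhattacharyya W \<le> 2 * t + (1 - info W) / (4 * t)"
proof -
  have "((\<lambda>y. t * (W 0 y + W 1 y) + (1 / (8 * t)) * (W 0 y + W 1 y + - 1 * pair_info (W 0 y) (W 1 y)))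
      has_sum (t * 2 + (1 / (8 * t)) * (2 + -1 * (2 * info W)))) UNIV"
    by (intro has_sum_cmult_right has_sum_add[OF has_sum_cmult_right[OF channel_has_sum_add]]
        has_sum_add[OF channel_has_sum_add] has_sum_pair_info assms)
  from has_sum_mono[OF has_sum_bhattacharyya[OF assms(1)] this] 
  have "bhattacharyya W \<le> t * 2 + (1 / (8 * t)) * (2 + -1 * (2 * info W))"
    using assms sqrt_le_pair_info_loss by fastforce
  then show ?thesis using assms(2) by (simp add: field_simps)
qed

section \<open>Channel splitting\<close>

lemma has_sum_sum:
  fixes f :: "'i \<Rightarrow> 'a \<Rightarrow> real"
  assumes "finite J" "\<And>i. i \<in> J \<Longrightarrow> (f i has_sum s i) A"
  shows "((\<lambda>x. \<Sum>i\<in>J. f i x) has_sum (\<Sum>i\<in>J. s i)) A"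
  using assms by (induction J rule: finite_induct) (auto intro: has_sum_add)

lemma has_sum_SplitI:
  fixes F :: "'y symbol \<Rightarrow> real"
  assumes F: "\<And>us. length us = j \<Longrightarrow> ((\<lambda>ys. F (Split ys us)) has_sum s us) {ys. length ys = l}"
    and 0: "\<And>y. F (Raw y) = 0" "\<And>ys us. \<not> (length ys = l \<and> length us = j) \<Longrightarrow> F (Split ys us) = 0"
  shows "(F has_sum (\<Sum>us | length us = j. s us)) UNIV"
proof -
  have "(F has_sum (\<Sum>us\<in>U. s us)) (\<Union>us\<in>U. (\<lambda>ys. Split ys us) ` {ys. length ys = l})"
    if "finite U" "U \<subseteq> {us. length us = j}" for U
    using that
  proof (induction U rule: finite_induct)
    case (insert u U)
    have "(F has_sum s u) ((\<lambda>ys. Split ys u) ` {ys. length ys = l})"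
      using F[of u] insert.prems by (subst has_sum_reindex) (auto simp: inj_on_def o_def)
    then have "(F has_sum s u + (\<Sum>us\<in>U. s us)) ((\<lambda>ys. Split ys u) ` {ys. length ys = l} \<union>
        (\<Union>us\<in>U. (\<lambda>ys. Split ys us) ` {ys. length ys = l}))"
      by (rule has_sum_Un_disjoint) (use insert in auto)
    then show ?case using insert by simp
  qed simp
  from this[of "{us. length us = j}"]
  have "(F has_sum (\<Sum>us | length us = j. s us))
      (\<Union>us\<in>{us. length us = j}. (\<lambda>ys. Split ys us) ` {ys. length ys = l})"
    by simp
  also have "?this \<longleftrightarrow> ?thesis"
  proof (rule has_sum_cong_neutral)
    show "F x = 0" if "x \<in> UNIV - (\<Union>us\<in>{us. length us = j}. (\<lambda>ys. Split ys us) ` {ys. length ys = l})" for x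
      using that 0 by (cases x) (auto simp: image_iff)
  qed auto
  finally show ?thesis .
qed

text \<open>Converse of \<open>has_sum_SplitI\<close>, with the side information summed inside for a
  fixed output word, which is the setting of the chain rule. Each slice is summable as a restriction
  of a summable function, and sums are unique.\<close>

lemma has_sum_SplitD:
  fixes F :: "'y symbol \<Rightarrow> real"
  assumes F: "(F has_sum S) UNIV"
    and 0: "\<And>y. F (Raw y) = 0" "\<And>ys us. \<not> (length ys = l \<and> length us = j) \<Longrightarrow> F (Split ys us) = 0"
  shows "((\<lambda>ys. \<Sum>us | length us = j. F (Split ys us)) has_sum S) {ys. length ys = l}"
proof -
  have s: "((\<lambda>ys. F (Split ys us)) has_sum (\<Sum>\<^sub>\<infinity>ys\<in>{ys. length ys = l}. F (Split ys us))) {ys. length ys = l}" for us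
  proof -
    have "F summable_on (\<lambda>ys. Split ys us) ` {ys. length ys = l}"
      by (rule summable_on_subset_banach[OF has_sum_imp_summable[OF F]]) auto
    then show ?thesis
      by (subst (asm) summable_on_reindex) (auto simp: inj_on_def o_def)
  qed
  have "S = (\<Sum>us | length us = j. \<Sum>\<^sub>\<infinity>ys\<in>{ys. length ys = l}. F (Split ys us))"
    using has_sum_unique[OF F has_sum_SplitI[OF s 0]] .
  then show ?thesis using s by (auto intro: has_sum_sum)
qed

section \<open>Encoding by an invertible kernel, and conservation of information\<close>

locale polarizing_kernel =
  fixes G :: "bit mat" and l :: nat
  assumes polarizing: "polarizing l G"
begin

lemma carrier_G: "G \<in> carrier_mat l l" and dim_row_G [simp]: "dim_row G = l" and dim_col_G [simp]: "dim_col G = l"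
  and invertible_G: "invertible_mat G"
  using polarizing by (auto simp: polarizing_def)

(* For us shorter than l this is the encoding of us padded with zeros. *)
definition encode :: "bit list \<Rightarrow> nat \<Rightarrow> bit" where
  "encode us i = (\<Sum>k<length us. G $$ (k, i) * us ! k)"

lemma encode_snoc: "encode (us @ [u]) i = encode us i + G $$ (length us, i) * u"
  by (simp add: encode_def nth_append)

lemma transpose_mult_vec_eq_encode:
  assumes "length us = l" "i < l"
  shows "(transpose_mat G *\<^sub>v vec_of_list us) $ i = encode us i"
  using assms
  by (simp add: scalar_prod_def encode_def lessThan_atLeast0 vec_of_list_index)

lemma encode_inject:
  assumes "length us = l" "length vs = l" "\<And>i. i < l \<Longrightarrow> encode us i = encode vs i"
  shows "us = vs"
proof -
  obtain B where B: "G * B = 1\<^sub>m l" "B * G = 1\<^sub>m (dim_row B)"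
    using invertible_G unfolding invertible_mat_def inverts_mat_def by auto
  have B_carrier: "B \<in> carrier_mat l l"
    using B by (metis carrier_matI dim_col_G index_mult_mat(3) index_one_mat(3))
  have eq: "transpose_mat G *\<^sub>v vec_of_list us = transpose_mat G *\<^sub>v vec_of_list vs"
    using assms by (intro eq_vecI) (auto simp: transpose_mult_vec_eq_encode simp del: index_mult_mat_vec)
  have inv: "transpose_mat B *\<^sub>v (transpose_mat G *\<^sub>v vec_of_list ws) = vec_of_list ws"
    if "length ws = l" for ws
  proof -
    have "vec_of_list ws \<in> carrier_vec l" using that by (simp add: carrier_vecI)
    then have "transpose_mat B *\<^sub>v (transpose_mat G *\<^sub>v vec_of_list ws)
        = transpose_mat (G * B) *\<^sub>v vec_of_list ws"
      using carrier_G B_carrier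
      by (subst transpose_mult[of _ l l _ l]) (auto simp: assoc_mult_mat_vec[of _ l l _ l])
    then show ?thesis using B \<open>vec_of_list ws \<in> carrier_vec l\<close> by simp
  qed
  have "vec_of_list us = vec_of_list vs"
    using inv[OF assms(1)] inv[OF assms(2)] unfolding eq by (rule trans[OF sym])
  then show ?thesis by (metis list_vec)
qed

lemma bij_betw_encode:
  "bij_betw (\<lambda>v. map (encode v) [0..<l]) {v. length v = l} {x. length x = l}"
proof -
  have inj: "inj_on (\<lambda>v. map (encode v) [0..<l]) {v. length v = l}"
    by (rule inj_onI) (auto intro: encode_inject)
  moreover have "(\<lambda>v. map (encode v) [0..<l]) ` {v. length v = l} = {x. length x = l}"
    by (rule card_subset_eq) (auto simp: card_image[OF inj])
  ultimately show ?thesis by (simp add: bij_betw_def)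
qed

text \<open>The substitution x = u G permutes the bit words of length l. It is used with
  \<open>F\<close> as \<open>xlog\<close> and as the identity.\<close>

lemma sum_encode:
  fixes F :: "real \<Rightarrow> real"
  shows "(\<Sum>v | length v = l. F (\<Prod>i<l. a i (encode v i))) = (\<Sum>x | length x = l. F (\<Prod>i<l. a i (x ! i)))"
proof -
  have "(\<Sum>x | length x = l. F (\<Prod>i<l. a i (x ! i)))
      = (\<Sum>v | length v = l. F (\<Prod>i<l. a i (map (encode v) [0..<l] ! i)))"
    by (rule sum.reindex_bij_betw[OF bij_betw_encode, symmetric])
  also have "\<dots> = (\<Sum>v | length v = l. F (\<Prod>i<l. a i (encode v i)))"
    by (intro sum.cong prod.cong arg_cong[of _ _ F]) auto
  finally show ?thesis by simp
qed

text \<open>With \<open>a i b\<close> as the probability of the i-th output given input b, this is a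
  transition probability of a split channel up to the factor 1 / 2^(l - 1). Arbitrary weights are
  allowed because facts about G are also read off from artificial ones.\<close>

definition prefix_likelihood :: "(nat \<Rightarrow> bit \<Rightarrow> real) \<Rightarrow> bit list \<Rightarrow> real" where
  "prefix_likelihood a = prefix_sum l (\<lambda>v. \<Prod>i<l. a i (encode v i))"

lemma split_channel_Split:
  assumes "length ys = l" "length us = j" "j < l"
  shows "split_channel G j W u (Split ys us)
    = 1 / 2 ^ (l - 1) * prefix_likelihood (\<lambda>i b. W b (ys ! i)) (us @ [u])"
proof -
  have "(\<Sum>vs | length vs = l - 1 - j. \<Prod>i<l. W ((transpose_mat G *\<^sub>v vec_of_list (us @ [u] @ vs)) $ i) (ys ! i))
      = (\<Sum>vs | length vs = l - 1 - j. \<Prod>i<l. W (encode (us @ [u] @ vs) i) (ys ! i))"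
    by (intro sum.cong prod.cong refl) (use assms in \<open>auto simp: transpose_mult_vec_eq_encode simp del: index_mult_mat_vec\<close>)
  then show ?thesis
    using assms by (simp add: prefix_likelihood_def prefix_sum_def)
qed

lemma split_channel_0:
  "split_channel G j W u (Raw y) = 0"
  "\<not> (length ys = l \<and> length us = j) \<Longrightarrow> split_channel G j W u (Split ys us) = 0"
  by auto

lemma channel_split_channel:
  assumes W: "channel W" and j: "j < l"
  shows "channel (split_channel G j W)"
  unfolding channel_def
proof (intro conjI allI)
  fix x
  show "0 \<le> split_channel G j W x y" for y
  proof (cases y)
    case (Split ys us)
    then show ?thesis using W by (auto intro!: divide_nonneg_nonneg sum_nonneg prod_nonneg)
  qed auto
  have "((\<lambda>ys. split_channel G j W x (Split ys us)) has_sum (1 / 2 ^ (l - 1) * 2 ^ (l - Suc j)))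
      {ys. length ys = l}" if us: "length us = j" for us
  proof -
    have "((\<lambda>ys. \<Sum>vs | length vs = l - Suc j. \<Prod>i<l. W (encode (us @ [x] @ vs) i) (ys ! i))
      has_sum (\<Sum>vs :: bit list | length vs = l - Suc j. \<Prod>i<l. 1)) {ys. length ys = l}"
      using W by (intro has_sum_sum has_sum_prod_lists) (auto simp: channel_has_sum)
    then have "((\<lambda>ys. prefix_likelihood (\<lambda>i b. W b (ys ! i)) (us @ [x])) has_sum 2 ^ (l - Suc j)) {ys. length ys = l}"
      using us by (simp add: prefix_likelihood_def prefix_sum_def)
    from has_sum_cmult_right[OF this, of "1 / 2 ^ (l - 1)"] show ?thesis
      by (rule has_sum_cong[THEN iffD1, rotated]) (use us j in \<open>simp add: split_channel_Split del: split_channel.simps\<close>)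
  qed
  from has_sum_SplitI[OF this split_channel_0]
  have "(split_channel G j W x has_sum (\<Sum>us :: bit list | length us = j. 1 / 2 ^ (l - 1) * 2 ^ (l - Suc j))) UNIV"
    by simp
  moreover have "(2::real) ^ (l - 1) = 2 ^ j * 2 ^ (l - Suc j)"
    using j by (simp flip: power_add)
  ultimately show "(split_channel G j W x has_sum 1) UNIV" by simp
qed

text \<open>Conservation of information. For a fixed output word the chain rule leaves
  \<open>xlog\<close> sums over all inputs; the encoding bijection makes the codeword bits free, so
  that these sums split over positions. Summation over output words then yields
  \<open>2 * info W\<close> at one position and 2 at each other, and the powers of 2 cancel the
  normalization.\<close>

lemma sum_info_split_channel:
  assumes W: "channel W"
  shows "(\<Sum>j<l. info (split_channel G j W)) = l * info W"
proof -
  define S where "S ys i = (\<Prod>k<l. if k = i then pair_info (W 0 (ys ! k)) (W 1 (ys ! k)) else W 0 (ys ! k) + W 1 (ys ! k))"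
    for ys i
  let ?P = "\<lambda>ys us j. pair_info (split_channel G j W 0 (Split ys us)) (split_channel G j W 1 (Split ys us))"
  have 1: "((\<lambda>ys. \<Sum>j<l. \<Sum>us | length us = j. ?P ys us j)
      has_sum (\<Sum>j<l. 2 * info (split_channel G j W))) {ys. length ys = l}"
  proof (intro has_sum_sum finite_lessThan)
    fix j assume "j \<in> {..<l}"
    then have "((\<lambda>y. pair_info (split_channel G j W 0 y) (split_channel G j W 1 y)) has_sum
       2 * info (split_channel G j W)) UNIV"
      by (intro has_sum_pair_info channel_split_channel W) auto
    then show "((\<lambda>ys. \<Sum>us | length us = j. ?P ys us j) has_sum 2 * info (split_channel G j W)) {ys. length ys = l}"
      by (rule has_sum_SplitD) (auto simp: pair_info_def)
  qed
  have eq: "(\<Sum>j<l. \<Sum>us | length us = j. ?P ys us j) = 1 / 2 ^ (l - 1) * (\<Sum>i<l. S ys i)"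
    if ys: "length ys = l" for ys
  proof -
    let ?L = "prefix_likelihood (\<lambda>i b. W b (ys ! i))"
    have P: "?P ys us j = 1 / 2 ^ (l - 1) * pair_info (?L (us @ [0])) (?L (us @ [1]))"
      if "length us = j" "j < l" for us j
      unfolding split_channel_Split[OF ys that] by (rule pair_info_scale) simp
    have "(\<Sum>j<l. \<Sum>us | length us = j. ?P ys us j)
        = (\<Sum>j<l. \<Sum>us | length us = j. 1 / 2 ^ (l - 1) * pair_info (?L (us @ [0])) (?L (us @ [1])))"
      by (intro sum.cong refl P) simp_all
    moreover have "(\<Sum>j<l. \<Sum>us | length us = j. pair_info (?L (us @ [0])) (?L (us @ [1]))) = (\<Sum>i<l. S ys i)"
    proof -
      define a where "a i b = W b (ys ! i)" for i b
      have a: "0 \<le> a i b" for i b using W by (simp add: a_def)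
      define p where "p v = (\<Prod>i<l. a i (encode v i))" for v
      have p: "0 \<le> p v" for v using a by (simp add: p_def prod_nonneg)
      have L: "?L = prefix_sum l p"
        unfolding prefix_likelihood_def p_def[abs_def] a_def ..
      have 1: "(\<Sum>v | length v = l. xlog (p v)) = (\<Sum>x | length x = l. xlog (\<Prod>i<l. a i (x ! i)))"
        unfolding p_def by (rule sum_encode)
      have 2: "(\<Sum>v | length v = l. p v) = (\<Prod>i<l. a i 0 + a i 1)"
        unfolding p_def sum_bit_lists_prod[of a, symmetric] by (rule sum_encode)
      have 3: "(\<Sum>i<l. S ys i) = (\<Sum>i<l. \<Prod>k<l. if k = i then pair_info (a k 0) (a k 1) else a k 0 + a k 1)"
        unfolding S_def a_def ..
      show ?thesis
        unfolding L prefix_information_chain[of p, OF p] 1 2 3 by (rule product_information[of a l, OF a])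
    qed
    ultimately show ?thesis
      by (simp only: sum_distrib_left[symmetric])
  qed
  have S: "((\<lambda>ys. S ys i) has_sum (2 * info W * 2 ^ (l - 1))) {ys. length ys = l}" if i: "i < l" for i
  proof -
    have "((\<lambda>ys. S ys i) has_sum (\<Prod>k<l. if k = i then 2 * info W else 2)) {ys. length ys = l}"
      unfolding S_def
      by (rule has_sum_prod_lists[where g = "\<lambda>k y. if k = i then pair_info (W 0 y) (W 1 y) else W 0 y + W 1 y"])
         (simp_all add: has_sum_pair_info channel_has_sum_add pair_info_nonneg W)
    moreover have "(\<Prod>k<l. if k = i then 2 * info W else 2) = 2 * info W * (2 ^ (l - 1))"
      using i by (simp add: prod.remove[of _ i])
    ultimately show ?thesis by simp
  qed
  have "((\<lambda>ys. 1 / 2 ^ (l - 1) * (\<Sum>i<l. S ys i)) has_sum (1 / 2 ^ (l - 1) * (\<Sum>i<l. 2 * info W * 2 ^ (l - 1)))) {ys. length ys = l}"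
    by (rule has_sum_cmult_right, rule has_sum_sum[OF finite_lessThan], rule S) simp
  then have "((\<lambda>ys. \<Sum>j<l. \<Sum>us | length us = j. ?P ys us j)
      has_sum (1 / 2 ^ (l - 1) * (\<Sum>i<l. 2 * info W * 2 ^ (l - 1)))) {ys. length ys = l}"
    by (rule has_sum_cong[THEN iffD1, rotated]) (simp add: eq del: split_channel.simps)
  from has_sum_unique[OF 1 this] have "2 * (\<Sum>j<l. info (split_channel G j W)) = 2 * (l * info W)"
    by (simp only: sum_distrib_left[symmetric]) simp
  then show ?thesis by simp
qed

(* With u_m, ..., u_(l-1) averaged out, the outputs at the positions in C carry no information, and the
   inputs at the other positions are determined by u_0, ..., u_(m-1). *)
definition marginalizes :: "nat \<Rightarrow> nat set \<Rightarrow> bool" where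
  "marginalizes m C \<longleftrightarrow> C \<subseteq> {..<l} \<and>
    (\<forall>a u. length u = m \<longrightarrow> prefix_likelihood a u = (\<Prod>i\<in>{..<l} - C. a i (encode u i)) * (\<Prod>i\<in>C. a i 0 + a i 1))"

lemma marginalizes_full: "marginalizes l {}"
  by (simp add: marginalizes_def prefix_likelihood_def prefix_sum_full)

lemma prefix_likelihood_split:
  "length u < l \<Longrightarrow> prefix_likelihood a u = prefix_likelihood a (u @ [0]) + prefix_likelihood a (u @ [1])"
  unfolding prefix_likelihood_def by (rule prefix_sum_split)

lemma bit_add_cases: "f (x :: bit) + f (x + 1) = f 0 + (f 1 :: real)"
  by (cases x) auto

lemma bit_mult_cases: "f (x :: bit) * f (x + 1) = f 0 * (f 1 :: real)"
  by (cases x) auto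

text \<open>Row m meets just one column c that is not yet averaged out. Summing over u_m thus lets
  the input at c run over both bits, whatever the earlier inputs are, and changes nothing
  else.\<close>

lemma marginalizes_insert:
  assumes marg: "marginalizes (Suc m) C" and m: "m < l" and c: "c < l" "c \<notin> C"
    and Gc: "G $$ (m, c) = 1" and G0: "\<And>i. i < l \<Longrightarrow> i \<notin> C \<Longrightarrow> i \<noteq> c \<Longrightarrow> G $$ (m, i) = 0"
  shows "marginalizes m (insert c C)"
  unfolding marginalizes_def
proof (intro conjI allI impI)
  have C: "C \<subseteq> {..<l}" "finite C"
    using marg finite_subset[of C "{..<l}"] by (auto simp: marginalizes_def)
  then show "insert c C \<subseteq> {..<l}" using c by simp
  fix a u assume u: "length (u :: bit list) = m"
  have eq: "prefix_likelihood a (u @ [b])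
      = a c (encode u c + b) * (\<Prod>i\<in>{..<l} - insert c C. a i (encode u i)) * (\<Prod>i\<in>C. a i 0 + a i 1)" for b
  proof -
    have "prefix_likelihood a (u @ [b]) = (\<Prod>i\<in>{..<l} - C. a i (encode (u @ [b]) i)) * (\<Prod>i\<in>C. a i 0 + a i 1)"
      using marg u by (simp add: marginalizes_def)
    also have "(\<Prod>i\<in>{..<l} - C. a i (encode (u @ [b]) i))
        = a c (encode (u @ [b]) c) * (\<Prod>i\<in>{..<l} - C - {c}. a i (encode (u @ [b]) i))"
      using c by (intro prod.remove) auto
    also have "(\<Prod>i\<in>{..<l} - C - {c}. a i (encode (u @ [b]) i)) = (\<Prod>i\<in>{..<l} - insert c C. a i (encode u i))"
      using G0 u by (intro prod.cong) (auto simp: encode_snoc)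
    finally show ?thesis using Gc u by (simp add: encode_snoc)
  qed
  show "prefix_likelihood a u = (\<Prod>i\<in>{..<l} - insert c C. a i (encode u i)) * (\<Prod>i\<in>insert c C. a i 0 + a i 1)"
    using u m c C bit_add_cases[of "a c" "encode u c"]
    by (subst prefix_likelihood_split) (auto simp: eq simp flip: distrib_right)
qed

(* If row m vanished outside C, flipping u_m would not change the likelihood of any prefix; over the
   noiseless channel this contradicts injectivity of the encoding. *)
lemma marginalizes_row_nonzero:
  assumes marg: "marginalizes (Suc m) C" and m: "m < l"
  obtains i where "i < l" "i \<notin> C" "G $$ (m, i) = 1"
proof -
  have "\<exists>i<l. i \<notin> C \<and> G $$ (m, i) \<noteq> 0"
  proof (rule ccontr)
    assume "\<not> ?thesis"
    then have G0: "\<And>i. i < l \<Longrightarrow> i \<notin> C \<Longrightarrow> G $$ (m, i) = 0" by auto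
    \<comment> \<open>With these weights \<open>prefix_likelihood\<close> counts the continuations
      whose whole word encodes to zero; the zero word shows that the count is positive for the
      prefix ending in 0.\<close>
    define a :: "nat \<Rightarrow> bit \<Rightarrow> real" where "a i b = (if b = 0 then 1 else 0)" for i b
    define u :: "bit list" where "u = replicate m 0"
    have [simp]: "length u = m" by (simp add: u_def)
    have zero: "encode (replicate k 0) i = 0" for k i
      by (simp add: encode_def)
    have prefix: "prefix_likelihood a (u @ [b])
       = (\<Sum>vs | length vs = l - Suc m. \<Prod>i<l. a i (encode (u @ [b] @ vs) i))" for b
      by (simp add: prefix_likelihood_def prefix_sum_def)
    have "prefix_likelihood a (u @ [0]) = prefix_likelihood a (u @ [1])"
      using marg G0 by (auto simp: marginalizes_def encode_snoc intro!: prod.cong)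
    moreover have "0 < prefix_likelihood a (u @ [0])"
      unfolding prefix
    proof (rule sum_pos2[of _ "replicate (l - Suc m) 0"])
      have "u @ [0] @ replicate (l - Suc m) 0 = replicate (m + Suc (l - Suc m)) 0"
        by (simp only: u_def replicate_add replicate_Suc append_Cons append_Nil)
      then show "0 < (\<Prod>i<l. a i (encode (u @ [0] @ replicate (l - Suc m) 0) i))"
        by (simp only: zero) (simp add: a_def)
    qed (auto intro!: prod_nonneg simp: a_def)
    ultimately have "prefix_likelihood a (u @ [1]) \<noteq> 0" by simp
    then obtain vs where vs: "length vs = l - Suc m" "(\<Prod>i<l. a i (encode (u @ [1] @ vs) i)) \<noteq> 0"
      unfolding prefix by (auto elim: sum.not_neutral_contains_not_neutral)
    then have "encode (u @ [1] @ vs) i = encode (replicate l 0) i" if "i < l" for i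
      using that zero by (auto simp: a_def split: if_splits)
    then have "u @ [1] @ vs = replicate l 0"
      using vs m by (intro encode_inject) auto
    then have "(u @ [1] @ vs) ! m = 0" using m by simp
    then show False by (simp add: nth_append)
  qed
  then show ?thesis using that by (metis bit.exhaust)
qed

(* If, going up from the last row, each row had exactly one new nonzero column, then ordering the columns
   accordingly would make G upper triangular. *)
lemma exists_weight_two_row:
  "\<exists>j<l. \<exists>C. marginalizes (Suc j) C \<and> card C = l - Suc j \<and>
    2 \<le> card {i \<in> {..<l} - C. G $$ (j, i) = 1}"
proof (rule ccontr)
  assume no: "\<not> ?thesis"
  \<comment> \<open>\<open>p r\<close> is the single new column met by row r, found by downward
    induction on m. The last conjunct is upper triangularity after the columns are ordered by
    \<open>p\<close>.\<close>
  have "\<exists>p. inj_on p {m..<l} \<and> p ` {m..<l} \<subseteq> {..<l} \<and> marginalizes m (p ` {m..<l}) \<and>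
      (\<forall>r\<in>{m..<l}. \<forall>c<l. c \<notin> p ` {r..<l} \<longrightarrow> G $$ (r, c) = 0)" if "m \<le> l" for m
    using that
  proof (induction m rule: inc_induct)
    case base
    show ?case using marginalizes_full by simp
  next
    case (step m)
    then obtain p where p: "inj_on p {Suc m..<l}" "p ` {Suc m..<l} \<subseteq> {..<l}"
      "marginalizes (Suc m) (p ` {Suc m..<l})"
      "\<And>r c. r \<in> {Suc m..<l} \<Longrightarrow> c < l \<Longrightarrow> c \<notin> p ` {r..<l} \<Longrightarrow> G $$ (r, c) = 0"
      by blast
    let ?C = "p ` {Suc m..<l}"
    obtain c where c: "c < l" "c \<notin> ?C" "G $$ (m, c) = 1"
      using marginalizes_row_nonzero[OF p(3) step.hyps(2)] .
    have one: "G $$ (m, i) = 0" if "i < l" "i \<notin> ?C" "i \<noteq> c" for i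
    proof (rule ccontr)
      assume "G $$ (m, i) \<noteq> 0"
      then have "{c, i} \<subseteq> {i \<in> {..<l} - ?C. G $$ (m, i) = 1}"
        using c that by (auto intro: bit.exhaust)
      from card_mono[OF _ this] have "2 \<le> card {i \<in> {..<l} - ?C. G $$ (m, i) = 1}"
        using that by simp
      moreover have "card ?C = l - Suc m" using p(1) by (simp add: card_image)
      ultimately show False using no that p(3) step.hyps(2) by blast
    qed
    let ?q = "p(m := c)"
    have im: "?q ` {r..<l} = p ` {r..<l}" if "m < r" for r
      using that by (intro image_cong) auto
    have int: "{m..<l} = insert m {Suc m..<l}" using step.hyps(2) by auto
    have im_m: "?q ` {m..<l} = insert c ?C"
      unfolding int image_insert im[OF lessI] by simp
    show ?case
    proof (intro exI[of _ ?q] conjI ballI allI impI)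
      show "inj_on ?q {m..<l}"
        unfolding int using p(1) c im[of "Suc m"] by (auto simp: inj_on_def)
      show "?q ` {m..<l} \<subseteq> {..<l}" unfolding im_m using p(2) c by simp
      show "marginalizes m (?q ` {m..<l})"
        unfolding im_m using p(3) step.hyps(2) c one by (rule marginalizes_insert)
      show "G $$ (r, d) = 0" if "r \<in> {m..<l}" "d < l" "d \<notin> ?q ` {r..<l}" for r d
      proof (cases "r = m")
        case True
        then show ?thesis using that one unfolding True im_m by blast
      next
        case False
        then show ?thesis using that p(4)[of r d] im[of r] by auto
      qed
    qed
  qed
  from this[of 0] obtain p where p: "inj_on p {..<l}" "p ` {..<l} \<subseteq> {..<l}"
      "\<And>r c. r < l \<Longrightarrow> c < l \<Longrightarrow> c \<notin> p ` {r..<l} \<Longrightarrow> G $$ (r, c) = 0"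
    by (auto simp: lessThan_atLeast0)
  define q where "q x = (if x < l then p x else x)" for x
  have "bij_betw p {..<l} {..<l}"
    using p endo_inj_surj[of "{..<l}" p] by (simp add: bij_betw_def)
  then have "bij_betw q {..<l} {..<l}"
    by (rule bij_betw_cong[THEN iffD1, rotated]) (simp add: q_def)
  then have "q permutes {..<l}"
    by (rule bij_imp_permutes) (simp add: q_def)
  moreover have "upper_triangular (mat l l (\<lambda>(i, j). G $$ (i, q j)))"
  proof (rule upper_triangularI)
    fix i j assume ij: "j < i" "i < dim_row (mat l l (\<lambda>(i, j). G $$ (i, q j)))"
    then have "p j \<notin> p ` {i..<l}" using ij by (subst inj_on_image_mem_iff[OF p(1)]) auto
    moreover have "p j < l" using p(2) ij image_subset_iff[of p "{..<l}" "{..<l}"] by auto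
    ultimately show "mat l l (\<lambda>(i, j). G $$ (i, q j)) $$ (i, j) = 0"
      using ij p(3) by (auto simp: q_def)
  qed
  ultimately show False using polarizing by (auto simp: polarizing_def)
qed

text \<open>With the later inputs averaged out, the hypotheses u_j = 0 and u_j = 1 differ exactly at
  the positions outside C where row j is 1. Each of these contributes one factor
  \<open>bhattacharyya W\<close>, for every value of the side information, since the product of both
  likelihoods is symmetric in the input.\<close>

lemma bhattacharyya_split_channel:
  assumes W: "channel W" and j: "j < l" and marg: "marginalizes (Suc j) C" and C: "card C = l - Suc j"
  shows "bhattacharyya (split_channel G j W) = bhattacharyya W ^ card {i \<in> {..<l} - C. G $$ (j, i) = 1}"
proof -
  let ?K = "{i \<in> {..<l} - C. G $$ (j, i) = 1}"
  have C_sub: "C \<subseteq> {..<l}" "finite C"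
    using marg finite_subset[of C "{..<l}"] by (auto simp: marginalizes_def)
  \<comment> \<open>One factor for each kind of position: averaged out, different under the two
    hypotheses, or equal under both.\<close>
  define g where "g us i y = (if i \<in> C then W 0 y + W 1 y else if G $$ (j, i) = 1 then sqrt (W 0 y * W 1 y)
      else W (encode us i) y)" for us i y
  have g_nn: "0 \<le> g us i y" for us i y using W by (simp add: g_def)
  have eq: "sqrt (split_channel G j W 0 (Split ys us) * split_channel G j W 1 (Split ys us))
      = 1 / 2 ^ (l - 1) * (\<Prod>i<l. g us i (ys ! i))" if "length ys = l" "length us = j" for ys us
  proof -
    let ?L = "prefix_likelihood (\<lambda>i b. W b (ys ! i))"
    have "(\<Prod>i\<in>{..<l} - C. W (encode (us @ [0]) i) (ys ! i)) * (\<Prod>i\<in>{..<l} - C. W (encode (us @ [1]) i) (ys ! i))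
        = (\<Prod>i\<in>{..<l} - C. g us i (ys ! i))\<^sup>2"
      unfolding prod.distrib[symmetric] prod_power_distrib
    proof (rule prod.cong)
      fix i assume "i \<in> {..<l} - C"
      then show "W (encode (us @ [0]) i) (ys ! i) * W (encode (us @ [1]) i) (ys ! i) = (g us i (ys ! i))\<^sup>2"
        using bit_mult_cases[of "\<lambda>b. W b (ys ! i)" "encode us i"] W that
        by (cases "G $$ (j, i)") (auto simp: g_def encode_snoc power2_eq_square)
    qed simp
    moreover have "(\<Prod>i\<in>C. W 0 (ys ! i) + W 1 (ys ! i)) = (\<Prod>i\<in>C. g us i (ys ! i))"
      by (rule prod.cong) (auto simp: g_def)
    moreover have "?L (us @ [b]) = (\<Prod>i\<in>{..<l} - C. W (encode (us @ [b]) i) (ys ! i)) *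
        (\<Prod>i\<in>C. W 0 (ys ! i) + W 1 (ys ! i))" for b
      using marg that by (simp add: marginalizes_def)
    moreover have "x0 * y * (x1 * y) = x0 * x1 * y\<^sup>2" for x0 x1 y :: real
      by (simp add: power2_eq_square)
    ultimately have "?L (us @ [0]) * ?L (us @ [1])
        = ((\<Prod>i\<in>{..<l} - C. g us i (ys ! i)) * (\<Prod>i\<in>C. g us i (ys ! i)))\<^sup>2"
      by (simp only: power_mult_distrib)
    also have "(\<Prod>i\<in>{..<l} - C. g us i (ys ! i)) * (\<Prod>i\<in>C. g us i (ys ! i)) = (\<Prod>i<l. g us i (ys ! i))"
      using C_sub by (intro prod.subset_diff[symmetric]) auto
    finally have "?L (us @ [0]) * ?L (us @ [1]) = (\<Prod>i<l. g us i (ys ! i))\<^sup>2" .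
    moreover have "split_channel G j W 0 (Split ys us) * split_channel G j W 1 (Split ys us)
        = (1 / 2 ^ (l - 1))\<^sup>2 * (?L (us @ [0]) * ?L (us @ [1]))"
      unfolding split_channel_Split[OF that j] by (simp only: power2_eq_square mult_ac)
    ultimately have "split_channel G j W 0 (Split ys us) * split_channel G j W 1 (Split ys us)
        = (1 / 2 ^ (l - 1) * (\<Prod>i<l. g us i (ys ! i)))\<^sup>2"
      by (simp only: power_mult_distrib)
    then show ?thesis
      using g_nn by (simp add: prod_nonneg del: split_channel.simps)
  qed
  have "((\<lambda>ys. sqrt (split_channel G j W 0 (Split ys us) * split_channel G j W 1 (Split ys us)))
      has_sum (1 / 2 ^ (l - 1) * (2 ^ (l - Suc j) * bhattacharyya W ^ card ?K))) {ys. length ys = l}"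
    if us: "length us = j" for us
  proof -
    have "((\<lambda>ys. \<Prod>i<l. g us i (ys ! i)) has_sum
        (\<Prod>i<l. if i \<in> C then 2 else if G $$ (j, i) = 1 then bhattacharyya W else 1)) {ys. length ys = l}"
      by (rule has_sum_prod_lists)
        (use W in \<open>auto simp: g_def channel_has_sum intro: has_sum_bhattacharyya channel_has_sum_add\<close>)
    also have "(\<Prod>i<l. if i \<in> C then 2 else if G $$ (j, i) = 1 then bhattacharyya W else 1)
        = (\<Prod>i\<in>{..<l} - C. if G $$ (j, i) = 1 then bhattacharyya W else 1) * (\<Prod>i\<in>C. 2)"
    proof -
      have "(\<Prod>i<l. h i) = (\<Prod>i\<in>{..<l} - C. h i) * (\<Prod>i\<in>C. h i)" for h :: "nat \<Rightarrow> real"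
        using C_sub by (intro prod.subset_diff) auto
      then show ?thesis by simp
    qed
    also have "(\<Prod>i\<in>{..<l} - C. if G $$ (j, i) = 1 then bhattacharyya W else 1) = (\<Prod>i\<in>?K. bhattacharyya W)"
      by (rule prod.inter_filter[symmetric]) simp
    finally have "((\<lambda>ys. \<Prod>i<l. g us i (ys ! i)) has_sum (2 ^ (l - Suc j) * bhattacharyya W ^ card ?K)) {ys. length ys = l}"
      by (simp add: C mult.commute)
    from has_sum_cmult_right[OF this, of "1 / 2 ^ (l - 1)"] show ?thesis
      by (rule has_sum_cong[THEN iffD1, rotated]) (simp add: us eq del: split_channel.simps)
  qed
  from has_sum_SplitI[OF this]
  have "((\<lambda>y. sqrt (split_channel G j W 0 y * split_channel G j W 1 y)) has_sum
     (\<Sum>us :: bit list | length us = j. 1 / 2 ^ (l - 1) * (2 ^ (l - Suc j) * bhattacharyya W ^ card ?K))) UNIV"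
    by (simp add: split_channel_0 del: split_channel.simps(2))
  \<comment> \<open>The \<open>2 ^ j\<close> values of the side information and the factor 2 from
    each averaged position together cancel the normalization.\<close>
  moreover have "(2::real) ^ (l - 1) = 2 ^ j * 2 ^ (l - Suc j)"
    using j by (simp flip: power_add)
  ultimately have "((\<lambda>y. sqrt (split_channel G j W 0 y * split_channel G j W 1 y)) has_sum
     bhattacharyya W ^ card ?K) UNIV" by simp
  from has_sum_unique[OF has_sum_bhattacharyya[OF channel_split_channel[OF W j]] this] show ?thesis .
qed

text \<open>The index depends on G and not on the channel, so the same digit can be repeated. A
  power with exponent at least 2 of a number in [0, 1] is at most its square.\<close>

lemma exists_squaring_index:
  "\<exists>j<l. \<forall>W :: 'y symbol channel. channel W \<longrightarrow> bhattacharyya (split_channel G j W) \<le> (bhattacharyya W)\<^sup>2"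
proof -
  obtain j C where j: "j < l" and C: "marginalizes (Suc j) C" "card C = l - Suc j"
    "2 \<le> card {i \<in> {..<l} - C. G $$ (j, i) = 1}"
    using exists_weight_two_row by blast
  have "bhattacharyya (split_channel G j W) \<le> (bhattacharyya W)\<^sup>2" if "channel W" for W :: "'y symbol channel"
    unfolding bhattacharyya_split_channel[OF that j C(1,2)]
    using C(3) bhattacharyya_nonneg[OF that] bhattacharyya_le_1[OF that] by (rule power_decreasing)
  with j show ?thesis by blast
qed

end

section \<open>Polarization\<close>

context polarizing_kernel
begin

text \<open>Indices are handled as digit words, most significant digit first, so that a prefix of
  the word is an initial run of splitting steps; \<open>bij_betw_digits\<close> leads back to
  numbers.\<close>

definition words :: "nat \<Rightarrow> nat list set" where
  "words n = {ds. length ds = n \<and> set ds \<subseteq> {..<l}}"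

definition word_channel :: "'y symbol channel \<Rightarrow> nat list \<Rightarrow> 'y symbol channel" where
  "word_channel W ds = fold (split_channel G) ds W"

definition proportion :: "nat \<Rightarrow> (nat list \<Rightarrow> bool) \<Rightarrow> real" where
  "proportion n P = card {ds \<in> words n. P ds} / l ^ n"

text \<open>A matrix with at most one row is upper triangular already.\<close>

lemma l_ge_2: "2 \<le> l"
proof (rule ccontr)
  assume "\<not> 2 \<le> l"
  then have "upper_triangular (mat l l (\<lambda>(i, j). G $$ (i, id j)))"
    by (auto intro!: upper_triangularI)
  then show False using polarizing permutes_id unfolding polarizing_def by blast
qed

lemma finite_words [simp]: "finite (words n)"
  using finite_lists_length_eq[of "{..<l}" n] by (simp add: words_def conj_commute)

lemma card_words: "card (words n) = l ^ n"
  using card_lists_length_eq[of "{..<l}" n] by (simp add: words_def conj_commute)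

lemma words_0: "words 0 = {[]}"
  by (auto simp: words_def)

lemma sum_words_append:
  fixes F :: "nat list \<Rightarrow> real"
  shows "(\<Sum>ds\<in>words (m + n). F ds) = (\<Sum>p\<in>words m. \<Sum>r\<in>words n. F (p @ r))"
proof -
  have "bij_betw (\<lambda>(p, r). p @ r) (words m \<times> words n) (words (m + n))"
    by (rule bij_betw_byWitness[where f' = "\<lambda>ds. (take m ds, drop m ds)"])
      (auto simp: words_def dest: in_set_takeD in_set_dropD)
  from sum.reindex_bij_betw[OF this, of F] show ?thesis
    by (simp add: sum.cartesian_product case_prod_unfold)
qed

lemma sum_words_1: "(\<Sum>ds\<in>words (Suc 0). F ds) = (\<Sum>j<l. F [j] :: real)"
proof -
  have "bij_betw (\<lambda>j. [j]) {..<l} (words (Suc 0))"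
    by (rule bij_betw_byWitness[where f' = hd]) (auto simp: words_def length_Suc_conv)
  from sum.reindex_bij_betw[OF this, of F] show ?thesis by simp
qed

lemma proportion_eq_sum: "proportion n P = (\<Sum>ds\<in>words n. of_bool (P ds)) / l ^ n"
proof -
  have "{ds \<in> words n. P ds} = words n \<inter> Collect P" by auto
  then show ?thesis by (simp add: proportion_def)
qed

lemma proportion_nonneg: "0 \<le> proportion n P"
  by (simp add: proportion_def)

lemma word_channel_append: "word_channel W (p @ r) = word_channel (word_channel W p) r"
  by (simp add: word_channel_def)

lemma word_channel_Nil [simp]: "word_channel W [] = W"
  by (simp add: word_channel_def)

lemma channel_word_channel: "channel W \<Longrightarrow> set ds \<subseteq> {..<l} \<Longrightarrow> channel (word_channel W ds)"
  by (induction ds arbitrary: W) (auto simp: word_channel_def channel_split_channel)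

lemma channel_word_channel': "channel W \<Longrightarrow> ds \<in> words n \<Longrightarrow> channel (word_channel W ds)"
  by (auto simp: words_def intro: channel_word_channel)

text \<open>For uniformly random digits this is the martingale property, over any number of
  steps.\<close>

lemma sum_info_word_channel:
  assumes "channel W"
  shows "(\<Sum>r\<in>words n. info (word_channel W r)) = l ^ n * info W"
proof (induction n)
  case (Suc n)
  have "(\<Sum>r\<in>words (n + Suc 0). info (word_channel W r))
      = (\<Sum>p\<in>words n. \<Sum>j<l. info (split_channel G j (word_channel W p)))"
    unfolding sum_words_append sum_words_1
    by (simp add: word_channel_append) (simp add: word_channel_def)
  also have "\<dots> = (\<Sum>p\<in>words n. l * info (word_channel W p))"
    using assms by (intro sum.cong sum_info_split_channel channel_word_channel' refl)
  finally show ?case using Suc by (simp flip: sum_distrib_left)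
qed (simp add: words_0)

definition info_energy :: "'y symbol channel \<Rightarrow> nat \<Rightarrow> real" where
  "info_energy W n = (\<Sum>ds\<in>words n. (info (word_channel W ds))\<^sup>2) / l ^ n"

text \<open>Orthogonality of martingale increments: after expansion of the square,
  \<open>sum_info_word_channel\<close> evaluates the cross term.\<close>

lemma info_energy_diff:
  assumes W: "channel W"
  shows "(\<Sum>p\<in>words n. \<Sum>r\<in>words t. (info (word_channel W (p @ r)) - info (word_channel W p))\<^sup>2)
    = l ^ (n + t) * (info_energy W (n + t) - info_energy W n)"
proof -
  have "(\<Sum>r\<in>words t. (info (word_channel W (p @ r)) - info (word_channel W p))\<^sup>2)
      = (\<Sum>r\<in>words t. (info (word_channel W (p @ r)))\<^sup>2) - l ^ t * (info (word_channel W p))\<^sup>2"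
    if p: "p \<in> words n" for p
  proof -
    let ?V = "word_channel W p"
    have V: "channel ?V" using channel_word_channel'[OF W p] .
    have "(\<Sum>r\<in>words t. (info (word_channel W (p @ r)) - info ?V)\<^sup>2)
        = (\<Sum>r\<in>words t. (info (word_channel W (p @ r)))\<^sup>2) - 2 * info ?V * (\<Sum>r\<in>words t. info (word_channel ?V r))
          + l ^ t * (info ?V)\<^sup>2"
      by (simp add: power2_diff sum.distrib sum_subtractf card_words word_channel_append sum_distrib_left mult_ac)
    then show ?thesis
      unfolding sum_info_word_channel[OF V] by (simp add: power2_eq_square)
  qed
  then have "(\<Sum>p\<in>words n. \<Sum>r\<in>words t. (info (word_channel W (p @ r)) - info (word_channel W p))\<^sup>2)
     = (\<Sum>ds\<in>words (n + t). (info (word_channel W ds))\<^sup>2) - l ^ t * (\<Sum>p\<in>words n. (info (word_channel W p))\<^sup>2)"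
    by (simp add: sum_words_append sum_subtractf sum_distrib_left)
  also have "\<dots> = l ^ (n + t) * (info_energy W (n + t) - info_energy W n)"
    using l_ge_2 by (simp add: info_energy_def power_add field_simps)
  finally show ?thesis .
qed

lemma info_energy_mono:
  assumes W: "channel W"
  shows "info_energy W n \<le> info_energy W (n + t)"
proof -
  have "0 \<le> l ^ (n + t) * (info_energy W (n + t) - info_energy W n)"
    unfolding info_energy_diff[OF W, symmetric] by (intro sum_nonneg) auto
  moreover have "0 < real l ^ (n + t)" using l_ge_2 by simp
  ultimately show ?thesis by (simp add: zero_le_mult_iff)
qed

lemma info_energy_le_1:
  assumes W: "channel W"
  shows "info_energy W n \<le> 1"
proof -
  have "(\<Sum>ds\<in>words n. (info (word_channel W ds))\<^sup>2) \<le> (\<Sum>ds\<in>words n. 1)"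
    using channel_word_channel'[OF W] by (intro sum_mono) (auto simp: power_le_one info_nonneg info_le_1)
  then show ?thesis using l_ge_2 by (simp add: info_energy_def card_words)
qed

lemma info_energy_diff_tendsto_0:
  assumes W: "channel W"
  shows "(\<lambda>n. info_energy W (n + t) - info_energy W n) \<longlonglongrightarrow> 0"
proof -
  have "incseq (info_energy W)"
    using info_energy_mono[OF W, of _ 1] by (intro incseq_SucI) simp
  then obtain L where L: "info_energy W \<longlonglongrightarrow> L"
    by (rule incseq_convergent[of "info_energy W" 1]) (auto simp: info_energy_le_1[OF W])
  from tendsto_diff[OF LIMSEQ_ignore_initial_segment[OF L, of t] L] show ?thesis by simp
qed

lemma polarization:
  fixes W :: "'y symbol channel"
  assumes W: "channel W" and \<delta>: "0 < \<delta>"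
  shows "(\<lambda>n. proportion n (\<lambda>ds. \<delta> < info (word_channel W ds) \<and> info (word_channel W ds) < 1 - \<delta>)) \<longlonglongrightarrow> 0"
    (is "(\<lambda>n. proportion n ?mid) \<longlonglongrightarrow> 0")
proof (cases "\<delta> < 1")
  case True
  obtain j where j: "j < l"
    "\<And>V :: 'y symbol channel. channel V \<Longrightarrow> bhattacharyya (split_channel G j V) \<le> (bhattacharyya V)\<^sup>2"
    using exists_squaring_index[where 'y = 'y] by blast
  have Z: "bhattacharyya (word_channel V (replicate t j)) \<le> bhattacharyya V ^ (2 ^ t)"
    if "channel V" for V :: "'y symbol channel" and t
    using that
  proof (induction t arbitrary: V)
    case (Suc t)
    have "bhattacharyya (word_channel V (replicate (Suc t) j)) = bhattacharyya (word_channel (split_channel G j V) (replicate t j))"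
      by (simp add: word_channel_def)
    also have "\<dots> \<le> bhattacharyya (split_channel G j V) ^ (2 ^ t)"
      using Suc j channel_split_channel by blast
    also have "\<dots> \<le> ((bhattacharyya V)\<^sup>2) ^ (2 ^ t)"
      using Suc j channel_split_channel by (intro power_mono bhattacharyya_nonneg) auto
    finally show ?case by (simp add: power_mult)
  qed simp
  \<comment> \<open>The number t of squarings is to bring every Bhattacharyya parameter up to 1 -
    \<delta>/4 down to \<delta>/4; information above \<delta> guarantees such a starting value by
    \<open>info_le_bhattacharyya\<close>.\<close>
  have "(\<lambda>t. (1 - \<delta> / 4) ^ t) \<longlonglongrightarrow> 0"
    using \<delta> True by (intro LIMSEQ_power_zero) auto
  from order_tendstoD(2)[OF this, of "\<delta> / 4"] obtain t0 where t0: "(1 - \<delta> / 4) ^ t0 < \<delta> / 4"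
    using \<delta> by (auto simp: eventually_sequentially)
  define t where "t = t0"
  have "t0 \<le> 2 ^ t" unfolding t_def by (rule less_imp_le[OF less_exp])
  then have "(1 - \<delta> / 4) ^ (2 ^ t) \<le> (1 - \<delta> / 4) ^ t0"
    using \<delta> True by (intro power_decreasing) auto
  then have t: "(1 - \<delta> / 4) ^ (2 ^ t) \<le> \<delta> / 4" using t0 by simp
  \<comment> \<open>Only the continuation by the repeated squaring digit is used: it raises the
    information from below 1 - \<delta> to at least 1 - \<delta>/2. It is one of l^t continuations,
    which later costs the fixed factor l^t.\<close>
  have jump: "(\<delta> / 2)\<^sup>2 \<le> (\<Sum>r\<in>words t. (info (word_channel W (p @ r)) - info (word_channel W p))\<^sup>2)"
    if p: "p \<in> words n" "?mid p" for p n
  proof -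
    let ?V = "word_channel W p" and ?r = "replicate t j"
    have V: "channel ?V" using channel_word_channel'[OF W p(1)] .
    have r: "?r \<in> words t" using j by (auto simp: words_def)
    have V': "channel (word_channel ?V ?r)" using channel_word_channel'[OF V r] .
    have "bhattacharyya ?V \<le> 1 - \<delta> / 4"
      using info_le_bhattacharyya[OF V] p by simp
    then have "bhattacharyya ?V ^ (2 ^ t) \<le> \<delta> / 4"
      by (rule order.trans[OF power_mono[OF _ bhattacharyya_nonneg[OF V]] t])
    then have "bhattacharyya (word_channel ?V ?r) \<le> \<delta> / 4"
      using Z[OF V, of t] by simp
    then have "1 - \<delta> / 2 \<le> info (word_channel ?V ?r)"
      using info_ge_bhattacharyya[OF V'] by simp
    then have "\<delta> / 2 \<le> info (word_channel W (p @ ?r)) - info ?V"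
      using p by (simp add: word_channel_append)
    then have "(\<delta> / 2)\<^sup>2 \<le> (info (word_channel W (p @ ?r)) - info ?V)\<^sup>2"
      using \<delta> by (intro power_mono) auto
    also have "\<dots> \<le> (\<Sum>r\<in>words t. (info (word_channel W (p @ r)) - info ?V)\<^sup>2)"
      using r by (intro member_le_sum) auto
    finally show ?thesis .
  qed
  have le: "proportion n ?mid \<le> l ^ t * (4 / \<delta>\<^sup>2) * (info_energy W (n + t) - info_energy W n)" for n
  proof -
    have "(\<delta> / 2)\<^sup>2 * card {p \<in> words n. ?mid p} = (\<Sum>p\<in>{p \<in> words n. ?mid p}. (\<delta> / 2)\<^sup>2)"
      by simp
    also have "\<dots> \<le> (\<Sum>p\<in>{p \<in> words n. ?mid p}. \<Sum>r\<in>words t. (info (word_channel W (p @ r)) - info (word_channel W p))\<^sup>2)"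
      using jump by (intro sum_mono) auto
    also have "\<dots> \<le> (\<Sum>p\<in>words n. \<Sum>r\<in>words t. (info (word_channel W (p @ r)) - info (word_channel W p))\<^sup>2)"
      by (intro sum_mono2) (auto intro: sum_nonneg)
    also have "\<dots> = l ^ (n + t) * (info_energy W (n + t) - info_energy W n)"
      by (rule info_energy_diff[OF W])
    finally have "card {p \<in> words n. ?mid p} \<le> (4 / \<delta>\<^sup>2) * (l ^ (n + t) * (info_energy W (n + t) - info_energy W n))"
      using \<delta> by (simp add: field_simps power2_eq_square)
    then have "proportion n ?mid \<le> (4 / \<delta>\<^sup>2) * (l ^ (n + t) * (info_energy W (n + t) - info_energy W n)) / l ^ n"
      unfolding proportion_def by (intro divide_right_mono) auto
    also have "\<dots> = l ^ t * (4 / \<delta>\<^sup>2) * (info_energy W (n + t) - info_energy W n)"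
      using l_ge_2 by (simp add: power_add)
    finally show ?thesis .
  qed
  have lim: "(\<lambda>n. l ^ t * (4 / \<delta>\<^sup>2) * (info_energy W (n + t) - info_energy W n)) \<longlonglongrightarrow> 0"
    using tendsto_mult_right_zero[OF info_energy_diff_tendsto_0[OF W]] .
  show ?thesis
    by (rule tendsto_sandwich[OF always_eventually always_eventually tendsto_const lim])
      (rule allI, rule proportion_nonneg, rule allI, rule le)
next
  case False
  then have none: "{ds \<in> words n. ?mid ds} = {}" for n by auto
  show ?thesis unfolding proportion_def none by simp
qed

text \<open>The information averages to \<open>info W\<close>; a good or an unpolarized channel
  contributes at most 1 to this average, a bad one at most \<kappa>.\<close>

lemma proportion_good_ge:
  assumes W: "channel W" and \<kappa>: "0 < \<kappa>"
  shows "info W - \<kappa> - proportion n (\<lambda>ds. \<kappa> < info (word_channel W ds) \<and> info (word_channel W ds) < 1 - \<kappa>)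
    \<le> proportion n (\<lambda>ds. 1 - \<kappa> \<le> info (word_channel W ds))"
proof -
  let ?I = "\<lambda>ds. info (word_channel W ds)"
  have "l ^ n * info W = (\<Sum>ds\<in>words n. ?I ds)"
    by (rule sum_info_word_channel[OF W, symmetric])
  also have "\<dots> \<le> (\<Sum>ds\<in>words n. of_bool (1 - \<kappa> \<le> ?I ds) + \<kappa> + of_bool (\<kappa> < ?I ds \<and> ?I ds < 1 - \<kappa>))"
    using channel_word_channel'[OF W] \<kappa> info_le_1 by (intro sum_mono) (fastforce simp: of_bool_def)
  finally have "info W \<le> (\<Sum>ds\<in>words n. of_bool (1 - \<kappa> \<le> ?I ds) + \<kappa> + of_bool (\<kappa> < ?I ds \<and> ?I ds < 1 - \<kappa>)) / l ^ n"
    using l_ge_2 by (simp add: field_simps)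
  also have "\<dots> = proportion n (\<lambda>ds. 1 - \<kappa> \<le> ?I ds) + \<kappa> + proportion n (\<lambda>ds. \<kappa> < ?I ds \<and> ?I ds < 1 - \<kappa>)"
    unfolding proportion_eq_sum sum.distrib add_divide_distrib using l_ge_2 by (simp add: card_words)
  finally show ?thesis by simp
qed

text \<open>Markov's inequality for the information, whose mean is \<open>info W\<close>.\<close>

lemma proportion_good_le:
  assumes W: "channel W" and \<kappa>: "\<kappa> < 1"
  shows "proportion n (\<lambda>ds. 1 - \<kappa> \<le> info (word_channel W ds)) \<le> info W / (1 - \<kappa>)"
proof -
  let ?I = "\<lambda>ds. info (word_channel W ds)"
  have "(\<Sum>ds\<in>words n. (1 - \<kappa>) * of_bool (1 - \<kappa> \<le> ?I ds)) \<le> (\<Sum>ds\<in>words n. ?I ds)"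
    using channel_word_channel'[OF W] info_nonneg by (intro sum_mono) (auto simp: of_bool_def)
  then have "(1 - \<kappa>) * (\<Sum>ds\<in>words n. of_bool (1 - \<kappa> \<le> ?I ds)) \<le> l ^ n * info W"
    by (simp only: sum_info_word_channel[OF W] sum_distrib_left[symmetric])
  then show ?thesis
    unfolding proportion_eq_sum using l_ge_2 \<kappa> by (simp add: divide_simps mult_ac)
qed

(* A final channel that is good comes from a channel after m steps that is good already, that is not yet
   polarized, or that is bad; the last case is rare by Markov's inequality for the information martingale. *)
lemma proportion_good_and_le:
  assumes W: "channel W" and \<kappa>: "0 < \<kappa>" "\<kappa> < 1" and b: "\<And>p. p \<in> words m \<Longrightarrow> proportion k (\<lambda>r. B (p @ r)) \<le> b" "0 \<le> b"
  shows "proportion (m + k) (\<lambda>ds. bhattacharyya (word_channel W ds) \<le> 1 / 4 \<and> B ds)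
    \<le> b * (info W / (1 - \<kappa>)) + proportion m (\<lambda>ds. \<kappa> < info (word_channel W ds) \<and> info (word_channel W ds) < 1 - \<kappa>) + 2 * \<kappa>"
proof -
  let ?I = "\<lambda>ds. info (word_channel W ds)"
  let ?good = "\<lambda>p. 1 - \<kappa> \<le> ?I p" and ?mid = "\<lambda>p. \<kappa> < ?I p \<and> ?I p < 1 - \<kappa>"
  let ?A = "\<lambda>ds. bhattacharyya (word_channel W ds) \<le> 1 / 4 \<and> B ds"
  have "(\<Sum>r\<in>words k. of_bool (?A (p @ r))) \<le> l ^ k * (of_bool (?good p) * b + of_bool (?mid p) + 2 * \<kappa>)"
    if p: "p \<in> words m" for p
  proof -
    consider "?good p" | "?mid p" | "?I p \<le> \<kappa>" by linarith
    then show ?thesis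
    proof cases
      case 1
      have "(\<Sum>r\<in>words k. of_bool (?A (p @ r))) \<le> (\<Sum>r\<in>words k. of_bool (B (p @ r)) :: real)"
        by (intro sum_mono) auto
      also have "\<dots> = l ^ k * proportion k (\<lambda>r. B (p @ r))"
        unfolding proportion_eq_sum using l_ge_2 by simp
      also have "\<dots> \<le> l ^ k * b" using b(1)[OF p] by (intro mult_left_mono) auto
      also have "\<dots> \<le> l ^ k * (of_bool (?good p) * b + of_bool (?mid p) + 2 * \<kappa>)"
        using 1 \<kappa> by (intro mult_left_mono) auto
      finally show ?thesis .
    next
      case 2
      have "(\<Sum>r\<in>words k. of_bool (?A (p @ r)) :: real) \<le> (\<Sum>r\<in>words k. 1)"
        by (intro sum_mono) auto
      also have "\<dots> = real l ^ k * 1" by (simp add: card_words)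
      also have "\<dots> \<le> real l ^ k * (of_bool (?good p) * b + of_bool (?mid p) + 2 * \<kappa>)"
        using 2 \<kappa> b(2) by (intro mult_left_mono) auto
      finally show ?thesis by simp
    next
      case 3
      have V: "channel (word_channel W p)" using channel_word_channel'[OF W p] .
      \<comment> \<open>A Bhattacharyya parameter of at most 1/4 forces information of at least 1/2,
        so twice the information dominates the indicator.\<close>
      have "(\<Sum>r\<in>words k. of_bool (?A (p @ r))) \<le> (\<Sum>r\<in>words k. 2 * ?I (p @ r))"
      proof (rule sum_mono)
        fix r assume "r \<in> words k"
        then have c: "channel (word_channel W (p @ r))"
          unfolding word_channel_append by (rule channel_word_channel'[OF V])
        show "of_bool (?A (p @ r)) \<le> 2 * ?I (p @ r)"
          using info_nonneg[OF c] info_ge_bhattacharyya[OF c] by auto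
      qed
      also have "\<dots> = 2 * (l ^ k * ?I p)"
        unfolding word_channel_append sum_distrib_left[symmetric] sum_info_word_channel[OF V] ..
      also have "\<dots> \<le> l ^ k * (2 * \<kappa>)" using 3 by (simp add: mult_left_mono)
      also have "\<dots> \<le> l ^ k * (of_bool (?good p) * b + of_bool (?mid p) + 2 * \<kappa>)"
        using b(2) by (intro mult_left_mono) auto
      finally show ?thesis .
    qed
  qed
  then have "(\<Sum>ds\<in>words (m + k). of_bool (?A ds))
      \<le> (\<Sum>p\<in>words m. l ^ k * (of_bool (?good p) * b + of_bool (?mid p) + 2 * \<kappa>))"
    unfolding sum_words_append by (intro sum_mono)
  then have "proportion (m + k) ?A
      \<le> (\<Sum>p\<in>words m. l ^ k * (of_bool (?good p) * b + of_bool (?mid p) + 2 * \<kappa>)) / l ^ (m + k)"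
    unfolding proportion_eq_sum by (intro divide_right_mono) auto
  also have "\<dots> = (\<Sum>p\<in>words m. of_bool (?good p) * b + of_bool (?mid p) + 2 * \<kappa>) / l ^ m"
    unfolding sum_distrib_left[symmetric] power_add using l_ge_2 by simp
  also have "\<dots> = b * proportion m ?good + proportion m ?mid + 2 * \<kappa>"
    unfolding proportion_eq_sum sum.distrib add_divide_distrib using l_ge_2
    by (simp add: card_words flip: sum_distrib_right)
  also have "\<dots> \<le> b * (info W / (1 - \<kappa>)) + proportion m ?mid + 2 * \<kappa>"
    using proportion_good_le[OF W \<kappa>(2)] b(2) by (intro add_right_mono mult_left_mono)
  finally show ?thesis .
qed

text \<open>Asymptotic independence: \<open>B\<close> may depend on all digits, but after any fixed
  prefix its proportion is asymptotically at most q. The choices are made in the order \<kappa>, m,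
  k, so that only finitely many prefixes have to be controlled at once when k grows.\<close>

lemma eventually_proportion_good_and_le:
  assumes W: "channel W" and q: "0 \<le> q" and \<epsilon>: "0 < \<epsilon>"
    and B: "\<And>m p b. p \<in> words m \<Longrightarrow> q < b \<Longrightarrow> \<forall>\<^sub>F k in sequentially. proportion k (\<lambda>r. B (p @ r)) \<le> b"
  shows "\<forall>\<^sub>F n in sequentially. proportion n (\<lambda>ds. bhattacharyya (word_channel W ds) \<le> 1 / 4 \<and> B ds) \<le> info W * q + \<epsilon>"
proof -
  \<comment> \<open>This is the bound of \<open>proportion_good_and_le\<close> for
    \<open>b = q + \<kappa>\<close> and an unpolarized proportion of at most \<kappa>.\<close>
  have "((\<lambda>\<kappa>. (q + \<kappa>) * (info W / (1 - \<kappa>)) + \<kappa> + 2 * \<kappa>) \<longlongrightarrow> (q + 0) * (info W / (1 - 0)) + 0 + 2 * 0) (at_right 0)"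
    by (intro tendsto_intros) auto
  then have "((\<lambda>\<kappa>. (q + \<kappa>) * (info W / (1 - \<kappa>)) + \<kappa> + 2 * \<kappa>) \<longlongrightarrow> info W * q) (at_right 0)"
    by (simp add: mult.commute)
  then have "\<forall>\<^sub>F \<kappa> in at_right 0. (q + \<kappa>) * (info W / (1 - \<kappa>)) + \<kappa> + 2 * \<kappa> < info W * q + \<epsilon>"
    using \<epsilon> by (intro order_tendstoD(2)) auto
  moreover have "\<forall>\<^sub>F \<kappa> in at_right (0 :: real). \<kappa> \<in> {0<..<1}"
    by (rule eventually_at_right_real) simp
  ultimately have "\<forall>\<^sub>F \<kappa> in at_right 0. \<kappa> \<in> {0<..<1} \<and> (q + \<kappa>) * (info W / (1 - \<kappa>)) + \<kappa> + 2 * \<kappa> < info W * q + \<epsilon>"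
    by eventually_elim auto
  from eventually_happens'[OF _ this] obtain \<kappa>
    where \<kappa>: "0 < \<kappa>" "\<kappa> < 1" "(q + \<kappa>) * (info W / (1 - \<kappa>)) + \<kappa> + 2 * \<kappa> < info W * q + \<epsilon>"
    by auto
  let ?mid = "\<lambda>ds. \<kappa> < info (word_channel W ds) \<and> info (word_channel W ds) < 1 - \<kappa>"
  have "\<forall>\<^sub>F m in sequentially. proportion m ?mid < \<kappa>"
    using order_tendstoD(2)[OF polarization[OF W \<kappa>(1)] \<kappa>(1)] .
  from eventually_happens'[OF _ this] obtain m where m: "proportion m ?mid < \<kappa>" by auto
  have "\<forall>\<^sub>F k in sequentially. \<forall>p\<in>words m. proportion k (\<lambda>r. B (p @ r)) \<le> q + \<kappa>"
    using B \<kappa> by (intro eventually_ball_finite) auto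
  then have "\<forall>\<^sub>F k in sequentially. proportion (k + m) (\<lambda>ds. bhattacharyya (word_channel W ds) \<le> 1 / 4 \<and> B ds) \<le> info W * q + \<epsilon>"
  proof eventually_elim
    case (elim k)
    then show ?case
      using proportion_good_and_le[OF W \<kappa>(1,2), of m k B "q + \<kappa>"] q \<kappa> m by (simp add: add.commute)
  qed
  then show ?thesis by (rule eventually_sequentially_seg[THEN iffD1])
qed

end

section \<open>The central limit theorem for uniform digits\<close>

interpretation std_normal: real_distribution std_normal_distribution
  by (rule real_dist_normal_dist)

lemma measure_std_normal:
  assumes "A \<in> sets borel"
  shows "measure std_normal_distribution A = (LINT z:A|lborel. exp (- z\<^sup>2 / 2) / sqrt (2 * pi))"
proof -
  have "measure std_normal_distribution A = (\<integral>x. indicator A x \<partial>std_normal_distribution)"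
    using assms by simp
  also have "\<dots> = (\<integral>x. std_normal_density x *\<^sub>R indicator A x \<partial>lborel)"
    using assms by (intro integral_density) auto
  finally show ?thesis
    by (simp add: set_lebesgue_integral_def std_normal_density_def mult.commute)
qed

lemma measure_std_normal_singleton: "measure std_normal_distribution {x} = 0"
proof -
  have "measure std_normal_distribution {x}
      = (\<integral>z. indicator {x} z *\<^sub>R (exp (- z\<^sup>2 / 2) / sqrt (2 * pi)) \<partial>lborel)"
    using measure_std_normal[of "{x}"] by (simp add: set_lebesgue_integral_def)
  also have "\<dots> = 0"
  proof (rule integral_eq_zero_AE)
    show "AE z in lborel. indicator {x} z *\<^sub>R (exp (- z\<^sup>2 / 2) / sqrt (2 * pi)) = 0"
      using AE_lborel_singleton[of x] by eventually_elim simp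
  qed
  finally show ?thesis .
qed

text \<open>The half-lines of \<open>Q\<close> and \<open>cdf\<close> share their endpoint, which
  carries no mass.\<close>

lemma Q_eq_cdf: "Q t = 1 - cdf std_normal_distribution t"
proof -
  have "Q t = measure std_normal_distribution {t..}"
    using measure_std_normal[of "{t..}"] by (simp add: Q_def)
  also have "{t..} = UNIV - {..<t}" by auto
  also have "measure std_normal_distribution \<dots> = 1 - measure std_normal_distribution {..<t}"
    using std_normal.prob_compl[of "{..<t}"] by simp
  also have "measure std_normal_distribution {..t} = measure std_normal_distribution ({..<t} \<union> {t})"
    by (rule arg_cong[where f = "measure std_normal_distribution"]) auto
  then have "measure std_normal_distribution {..<t} = measure std_normal_distribution {..t}"
    by (subst (asm) std_normal.finite_measure_Union) (auto simp: measure_std_normal_singleton)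
  finally show ?thesis by (simp add: cdf_def)
qed

lemma isCont_cdf_std_normal: "isCont (cdf std_normal_distribution) x"
  by (simp add: std_normal.isCont_cdf measure_std_normal_singleton)

text \<open>On a bounded interval the density has a positive lower bound. Strictness makes
  \<open>inv_into UNIV Q\<close> a genuine inverse on the range, and it gives the room
  \<open>Q t < R / info W\<close> for t beyond the quantile.\<close>

lemma Q_strict_antimono:
  assumes "s < t"
  shows "Q t < Q s"
proof -
  define b where "b = max \<bar>s\<bar> \<bar>t\<bar>"
  define c where "c = exp (- b\<^sup>2 / 2) / sqrt (2 * pi)"
  have le: "c \<le> std_normal_density z" if "z \<in> {s<..t}" for z
  proof -
    have "\<bar>z\<bar> \<le> \<bar>b\<bar>" using that by (auto simp: b_def)
    then have "z\<^sup>2 \<le> b\<^sup>2" by (simp add: abs_le_square_iff)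
    then show ?thesis by (simp add: c_def std_normal_density_def divide_right_mono)
  qed
  have "0 < c" by (simp add: c_def)
  then have "0 < ennreal c * ennreal (t - s)" using assms by (simp add: ennreal_zero_less_mult_iff)
  also have "\<dots> = (\<integral>\<^sup>+z. ennreal c * indicator {s<..t} z \<partial>lborel)"
    using assms by (simp add: nn_integral_cmult)
  also have "\<dots> \<le> (\<integral>\<^sup>+z. ennreal (std_normal_density z) * indicator {s<..t} z \<partial>lborel)"
    using le by (intro nn_integral_mono) (auto split: split_indicator intro: ennreal_leI)
  also have "\<dots> = emeasure std_normal_distribution {s<..t}"
    by (subst emeasure_density) auto
  finally have "0 < measure std_normal_distribution {s<..t}"
    by (simp add: std_normal.emeasure_eq_measure)
  then show ?thesis
    using std_normal.cdf_diff_eq[OF assms] by (simp add: Q_eq_cdf)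
qed

lemma Q_surj:
  assumes "0 < p" "p < 1"
  shows "\<exists>x. Q x = p"
proof -
  let ?F = "cdf std_normal_distribution"
  have "\<forall>\<^sub>F x in at_bot. ?F x < 1 - p"
    using std_normal.cdf_lim_at_bot assms by (intro order_tendstoD(2)) auto
  then obtain a where a: "?F a < 1 - p" using eventually_happens'[OF trivial_limit_at_bot_linorder] by blast
  have "\<forall>\<^sub>F x in at_top. 1 - p < ?F x"
    using std_normal.cdf_lim_at_top_prob assms by (intro order_tendstoD(1)) auto
  then obtain b where b: "1 - p < ?F b" using eventually_happens'[OF trivial_limit_at_top_linorder] by blast
  have "a \<le> b" using a b std_normal.cdf_nondecreasing[of b a] by (cases "a \<le> b") auto
  then obtain x where "?F x = 1 - p"
    using IVT[of ?F a "1 - p" b] a b isCont_cdf_std_normal by auto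
  then show ?thesis by (intro exI[of _ x]) (simp add: Q_eq_cdf)
qed

lemma Q_inv_into: "0 < p \<Longrightarrow> p < 1 \<Longrightarrow> Q (inv_into UNIV Q p) = p"
  using Q_surj by (intro f_inv_into_f) auto

lemma Q_nonneg: "0 \<le> Q t"
  using std_normal.cdf_bounded_prob[of t] by (simp add: Q_eq_cdf)

section \<open>Uniformly random digit sequences\<close>

locale uniform_digits =
  fixes l :: nat
  assumes l_pos: "0 < l"
begin

definition digit_space :: "(nat \<Rightarrow> nat) measure" where
  "digit_space = PiM UNIV (\<lambda>_. uniform_count_measure {..<l})"

sublocale D: prob_space "uniform_count_measure {..<l}"
  using l_pos by (intro prob_space_uniform_count_measure) auto

sublocale P: product_prob_space "\<lambda>_. uniform_count_measure {..<l}" "UNIV :: nat set"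
  by unfold_locales

sublocale S: prob_space digit_space
  unfolding digit_space_def by (rule prob_space_PiM) (rule D.prob_space_axioms)

lemma space_digit_space: "space digit_space = {\<omega>. \<forall>i. \<omega> i < l}"
  by (auto simp: digit_space_def space_PiM PiE_def Pi_def space_uniform_count_measure)

text \<open>The central limit theorem speaks of one sequence of independent variables on one space,
  so counts of words are turned into probabilities for an infinite digit sequence; each word is a
  cylinder of measure 1 / l^n.\<close>

lemma prob_digits_eq:
  fixes B :: "nat list \<Rightarrow> bool"
  shows "measure digit_space {\<omega> \<in> space digit_space. B (map \<omega> [0..<n])}
    = card {ds. length ds = n \<and> set ds \<subseteq> {..<l} \<and> B ds} / l ^ n"
proof -
  let ?W = "{ds. length ds = n \<and> set ds \<subseteq> {..<l} \<and> B ds}"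
  let ?E = "\<lambda>ds. {\<omega> \<in> space digit_space. map \<omega> [0..<n] = ds}"
  have fin: "finite ?W"
    by (rule finite_subset[OF _ finite_lists_length_eq[of "{..<l}" n]]) auto
  have E: "?E ds = prod_emb UNIV (\<lambda>_. uniform_count_measure {..<l}) {..<n} (PiE {..<n} (\<lambda>i. {ds ! i}))"
    if "ds \<in> ?W" for ds
    using that
    by (auto simp: prod_emb_def space_digit_space space_PiM PiE_def Pi_def space_uniform_count_measure
        list_eq_iff_nth_eq restrict_def extensional_def)
  have nth: "ds ! i < l" if "ds \<in> ?W" "i < n" for ds i
    using that by (metis (mono_tags, lifting) lessThan_iff mem_Collect_eq nth_mem subsetD)
  have sets: "?E ds \<in> sets digit_space" if "ds \<in> ?W" for ds
    unfolding E[OF that] unfolding digit_space_def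
    using nth[OF that] by (intro sets_PiM_I) (auto simp: sets_uniform_count_measure)
  have prob: "measure digit_space (?E ds) = 1 / l ^ n" if "ds \<in> ?W" for ds
  proof -
    have "measure digit_space (?E ds) = (\<Prod>i<n. measure (uniform_count_measure {..<l}) {ds ! i})"
      unfolding E[OF that] unfolding digit_space_def
      using nth[OF that] by (intro P.measure_PiM_emb) (auto simp: sets_uniform_count_measure)
    also have "\<dots> = (\<Prod>i<n. 1 / l)"
      using nth[OF that] by (intro prod.cong) (auto simp: measure_uniform_count_measure)
    finally show ?thesis by (simp add: power_divide)
  qed
  have "{\<omega> \<in> space digit_space. B (map \<omega> [0..<n])} = (\<Union>ds\<in>?W. ?E ds)"
    by (auto simp: space_digit_space)
  also have "measure digit_space \<dots> = (\<Sum>ds\<in>?W. measure digit_space (?E ds))"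
    using fin sets by (intro S.finite_measure_finite_Union) (auto simp: disjoint_family_on_def)
  also have "\<dots> = (\<Sum>ds\<in>?W. 1 / l ^ n)"
    by (rule sum.cong[OF refl prob])
  finally show ?thesis by simp
qed

lemma central_limit_digits:
  fixes X :: "nat \<Rightarrow> real" and \<mu> v :: real
  defines "\<mu> \<equiv> (\<Sum>i<l. X i) / l"
  defines "v \<equiv> (\<Sum>i<l. (X i - \<mu>)\<^sup>2) / l"
  assumes v: "0 < v"
  shows "(\<lambda>n. card {ds. length ds = n \<and> set ds \<subseteq> {..<l} \<and> (\<Sum>d\<leftarrow>ds. X d) > n * \<mu> + sqrt (n * v) * t} / l ^ n) \<longlonglongrightarrow> Q t"
proof -
  let ?N = "uniform_count_measure {..<l}"
  let ?X = "\<lambda>i \<omega>. X (\<omega> i)"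
  have meas_N: "f \<in> borel_measurable ?N" for f :: "nat \<Rightarrow> real"
    by (simp add: measurable_def space_uniform_count_measure sets_uniform_count_measure)
  have comp: "(\<lambda>\<omega>. \<omega> i) \<in> measurable digit_space ?N" for i
    unfolding digit_space_def by simp
  have distr: "distr digit_space ?N (\<lambda>\<omega>. \<omega> i) = ?N" for i
    unfolding digit_space_def by (rule distr_PiM_component) (auto intro: D.prob_space_axioms)
  have exp: "S.expectation (\<lambda>\<omega>. f (\<omega> i)) = (\<Sum>j<l. f j) / l" for f :: "nat \<Rightarrow> real" and i
  proof -
    have "S.expectation (\<lambda>\<omega>. f (\<omega> i)) = integral\<^sup>L (distr digit_space ?N (\<lambda>\<omega>. \<omega> i)) f"
      by (rule integral_distr[symmetric, OF comp meas_N])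
    then show ?thesis by (simp add: distr integral_uniform_count_measure)
  qed
  have int: "integrable digit_space (\<lambda>\<omega>. f (\<omega> i))" for f :: "nat \<Rightarrow> real" and i
  proof (rule S.integrable_const_bound[where B = "\<Sum>j<l. \<bar>f j\<bar>"])
    show "(\<lambda>\<omega>. f (\<omega> i)) \<in> borel_measurable digit_space"
      by (rule measurable_compose[OF comp meas_N])
    show "AE \<omega> in digit_space. norm (f (\<omega> i)) \<le> (\<Sum>j<l. \<bar>f j\<bar>)"
      by (rule AE_I2) (auto simp: space_digit_space intro!: member_le_sum)
  qed
  have "S.indep_vars (\<lambda>_. ?N) (\<lambda>i \<omega>. \<omega> i) UNIV"
  proof (subst S.indep_vars_iff_distr_eq_PiM)
    show "distr digit_space (Pi\<^sub>M UNIV (\<lambda>_. ?N)) (\<lambda>x. \<lambda>i\<in>UNIV. x i) = Pi\<^sub>M UNIV (\<lambda>i. distr digit_space ?N (\<lambda>\<omega>. \<omega> i))"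
      unfolding distr
      by (simp add: restrict_UNIV digit_space_def distr_id[of "Pi\<^sub>M UNIV (\<lambda>_. ?N)", unfolded id_def])
  qed (auto intro: comp)
  then have indep: "S.indep_vars (\<lambda>_. borel) ?X UNIV"
    by (rule S.indep_vars_compose2) (rule meas_N)
  have "weak_conv_m (\<lambda>n. distr digit_space borel (\<lambda>\<omega>. (\<Sum>i<n. ?X i \<omega> - \<mu>) / sqrt (n * (sqrt v)\<^sup>2))) std_normal_distribution"
  proof (rule S.central_limit_theorem[OF indep])
    show "S.expectation (?X n) = \<mu>" for n by (simp add: exp \<mu>_def)
    show "S.variance (?X n) = (sqrt v)\<^sup>2" for n
      using v by (simp add: exp[of X] exp[of "\<lambda>j. (X j - \<mu>)\<^sup>2"] flip: \<mu>_def) (simp add: v_def)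
    show "integrable digit_space (\<lambda>x. (X (x n))\<^sup>2)" for n
      by (rule int)
    show "distr digit_space borel (?X n) = distr ?N borel X" for n
      using distr_distr[OF meas_N[of X] comp[of n]] by (simp add: distr o_def)
  qed (use v in auto)
  then have conv: "(\<lambda>n. cdf (distr digit_space borel (\<lambda>\<omega>. (\<Sum>i<n. ?X i \<omega> - \<mu>) / sqrt (n * v))) t)
      \<longlonglongrightarrow> cdf std_normal_distribution t"
    using v isCont_cdf_std_normal by (simp add: weak_conv_m_def weak_conv_def)
  \<comment> \<open>The strict inequality in the count is the complement of the one in
    \<open>cdf\<close>. At n = 0 the normalization vanishes, so the identity is shown from n = 1 on,
    which suffices for the limit.\<close>
  have eq: "1 - cdf (distr digit_space borel (\<lambda>\<omega>. (\<Sum>i<n. ?X i \<omega> - \<mu>) / sqrt (n * v))) t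
      = card {ds. length ds = n \<and> set ds \<subseteq> {..<l} \<and> (\<Sum>d\<leftarrow>ds. X d) > n * \<mu> + sqrt (n * v) * t} / l ^ n"
    if n: "0 < n" for n :: nat
  proof -
    let ?S = "\<lambda>\<omega>. (\<Sum>i<n. ?X i \<omega> - \<mu>) / sqrt (n * v)"
    have S: "?S \<in> borel_measurable digit_space"
      using int by (intro borel_measurable_divide borel_measurable_sum borel_measurable_diff) auto
    have pos: "0 < sqrt (n * v)" using n v by simp
    have "1 - cdf (distr digit_space borel ?S) t = 1 - measure digit_space {\<omega> \<in> space digit_space. ?S \<omega> \<le> t}"
      using S by (simp add: cdf_def measure_distr vimage_def Int_def conj_commute)
    also have "\<dots> = measure digit_space {\<omega> \<in> space digit_space. \<not> ?S \<omega> \<le> t}"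
      using S by (subst S.prob_neg) auto
    also have "{\<omega> \<in> space digit_space. \<not> ?S \<omega> \<le> t}
        = {\<omega> \<in> space digit_space. (\<Sum>d\<leftarrow>map \<omega> [0..<n]. X d) > n * \<mu> + sqrt (n * v) * t}"
    proof -
      have "(\<Sum>d\<leftarrow>map \<omega> [0..<n]. X d) = (\<Sum>i<n. X (\<omega> i))" for \<omega>
        by (simp add: interv_sum_list_conv_sum_set_nat lessThan_atLeast0 o_def)
      then have "\<not> ?S \<omega> \<le> t \<longleftrightarrow> (\<Sum>d\<leftarrow>map \<omega> [0..<n]. X d) > n * \<mu> + sqrt (n * v) * t" for \<omega>
        using pos by (simp add: sum_subtractf not_le pos_less_divide_eq algebra_simps)
      then show ?thesis by blast
    qed
    finally show ?thesis by (simp only: prob_digits_eq[of "\<lambda>ds. (\<Sum>d\<leftarrow>ds. X d) > n * \<mu> + sqrt (n * v) * t"])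
  qed
  have ev: "\<forall>\<^sub>F n in sequentially. 1 - cdf (distr digit_space borel (\<lambda>\<omega>. (\<Sum>i<n. ?X i \<omega> - \<mu>) / sqrt (n * v))) t
      = card {ds. length ds = n \<and> set ds \<subseteq> {..<l} \<and> (\<Sum>d\<leftarrow>ds. X d) > n * \<mu> + sqrt (n * v) * t} / l ^ n"
    by (rule eventually_mono[OF eventually_gt_at_top[of 0] eq])
  show ?thesis
    unfolding Q_eq_cdf by (rule Lim_transform_eventually[OF tendsto_diff[OF tendsto_const conv] ev])
qed

end

section \<open>Row weights and decoding errors\<close>

lemma hamming_weight_bit: "hamming_weight v = card {i. i < dim_vec v \<and> v $ i = 1}"
  unfolding hamming_weight_def by (rule arg_cong[where f = card]) (auto intro: bit.exhaust)

text \<open>A product of bits is nonzero exactly if both factors are, so the support of the row is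
  in bijection with the Cartesian product of two supports.\<close>

lemma hamming_weight_kronecker:
  fixes A B :: "bit mat"
  assumes i: "i < dim_row A * dim_row B"
  shows "hamming_weight (row (kronecker A B) i)
    = hamming_weight (row A (i div dim_row B)) * hamming_weight (row B (i mod dim_row B))"
proof -
  let ?rA = "row A (i div dim_row B)" and ?rB = "row B (i mod dim_row B)"
  let ?n = "dim_col B"
  have i': "i div dim_row B < dim_row A" "i mod dim_row B < dim_row B"
    using i by (auto simp: less_mult_imp_div_less) (metis mod_less_divisor mult_0_right not_gr_zero not_less_zero)
  have row: "row (kronecker A B) i $ j = ?rA $ (j div ?n) * ?rB $ (j mod ?n)" if "j < dim_col A * ?n" for j
  proof -
    have "j div ?n < dim_col A" "j mod ?n < ?n"
      using that by (auto simp: less_mult_imp_div_less) (metis mod_less_divisor mult_0_right not_gr_zero not_less_zero)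
    then show ?thesis using that i i' by (simp add: kronecker_def)
  qed
  have dim: "dim_vec (row (kronecker A B) i) = dim_col A * ?n"
    by (simp add: kronecker_def)
  have "bij_betw (\<lambda>(a, b). a * ?n + b)
     ({a. a < dim_vec ?rA \<and> ?rA $ a \<noteq> 0} \<times> {b. b < dim_vec ?rB \<and> ?rB $ b \<noteq> 0})
     {j. j < dim_vec (row (kronecker A B) i) \<and> row (kronecker A B) i $ j \<noteq> 0}"
  proof (rule bij_betw_byWitness[where f' = "\<lambda>j. (j div ?n, j mod ?n)"], goal_cases)
    case 3
    show ?case
    proof (rule image_subsetI)
      fix p assume "p \<in> {a. a < dim_vec ?rA \<and> ?rA $ a \<noteq> 0} \<times> {b. b < dim_vec ?rB \<and> ?rB $ b \<noteq> 0}"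
      then obtain a b where p: "p = (a, b)" and a: "a < dim_vec ?rA" "?rA $ a \<noteq> 0"
        and b: "b < dim_vec ?rB" "?rB $ b \<noteq> 0"
        by blast
      have "a * ?n + b < Suc a * ?n" using b by simp
      also have "\<dots> \<le> dim_col A * ?n" using a by (intro mult_right_mono) auto
      finally have lt: "a * ?n + b < dim_col A * ?n" .
      have "row (kronecker A B) i $ (a * ?n + b) = ?rA $ a * ?rB $ b"
        using b unfolding row[OF lt] by simp
      then show "(case p of (a, b) \<Rightarrow> a * ?n + b)
          \<in> {j. j < dim_vec (row (kronecker A B) i) \<and> row (kronecker A B) i $ j \<noteq> 0}"
        using lt a(2) b(2) unfolding dim p by (simp del: index_row)
    qed
  next
    case 4
    show ?case
    proof (rule image_subsetI)
      fix j assume "j \<in> {j. j < dim_vec (row (kronecker A B) i) \<and> row (kronecker A B) i $ j \<noteq> 0}"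
      then have j: "j < dim_vec (row (kronecker A B) i)" "row (kronecker A B) i $ j \<noteq> 0"
        by blast+
      then have lt: "j < dim_col A * ?n" unfolding dim by simp
      moreover have "j div ?n < dim_col A" "j mod ?n < ?n"
        using lt by (auto simp: less_mult_imp_div_less) (metis mod_less_divisor mult_0_right not_gr_zero not_less_zero)
      ultimately show "(j div ?n, j mod ?n) \<in> {a. a < dim_vec ?rA \<and> ?rA $ a \<noteq> 0} \<times> {b. b < dim_vec ?rB \<and> ?rB $ b \<noteq> 0}"
        using j(2) unfolding row[OF lt] by (auto simp del: index_row(1))
    qed
  qed auto
  from bij_betw_same_card[OF this] show ?thesis
    by (simp add: hamming_weight_def card_cartesian_product)
qed

text \<open>The leading digit is the row index that \<open>kronecker\<close> passes to its left
  factor; the remainder is the one for the right factor.\<close>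

lemma digits_Suc:
  assumes "k < l ^ Suc n"
  shows "digits l (Suc n) k = (k div l ^ n) # digits l n (k mod l ^ n)"
proof -
  have l: "0 < l" using assms by (cases l) auto
  have "k div l ^ n < l" using assms by (simp add: less_mult_imp_div_less)
  moreover have "k div l ^ (n - Suc m) mod l = k mod l ^ n div l ^ (n - Suc m) mod l" if "m < n" for m
  proof -
    let ?e = "n - Suc m"
    have "l ^ n = l ^ ?e * l ^ Suc m"
      using that power_add[of l ?e "Suc m"] by simp
    then have "k mod l ^ n = l ^ ?e * (k div l ^ ?e mod l ^ Suc m) + k mod l ^ ?e"
      by (simp only: mod_mult2_eq)
    then have "k mod l ^ n div l ^ ?e = k div l ^ ?e mod l ^ Suc m"
      using l by simp
    then show ?thesis by (simp add: mod_mod_cancel)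
  qed
  moreover have "[0..<Suc n] = 0 # map Suc [0..<n]"
    by (simp add: upt_conv_Cons map_Suc_upt del: upt_Suc)
  ultimately show ?thesis
    by (simp add: digits_def del: upt_Suc)
qed

lemma digits_0 [simp]: "digits l 0 k = []"
  by (simp add: digits_def)

text \<open>For a channel this is one minus the total variation distance of the two output
  distributions, or twice the least error probability in guessing a uniform input from one
  output.\<close>

definition overlap :: "'y channel \<Rightarrow> real" where
  "overlap W = (\<Sum>\<^sub>\<infinity>y. min (W 0 y) (W 1 y))"

lemma has_sum_overlap:
  assumes "channel W"
  shows "((\<lambda>y. min (W 0 y) (W 1 y)) has_sum overlap W) UNIV"
proof -
  have "(\<lambda>y. min (W 0 y) (W 1 y)) summable_on UNIV"
    by (rule summable_on_comparison_test[OF has_sum_imp_summable[OF channel_has_sum[OF assms, of 0]]])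
      (use assms in auto)
  then show ?thesis by (simp add: overlap_def)
qed

lemma overlap_le_1: "channel W \<Longrightarrow> overlap W \<le> 1"
  using has_sum_mono[OF has_sum_overlap channel_has_sum[of W 0]] by simp

text \<open>Without overlap no output has positive probability under both inputs; then the
  Bhattacharyya parameter is 0 and the information is at least 1.\<close>

lemma overlap_pos:
  assumes W: "channel W" and I: "info W < 1"
  shows "0 < overlap W"
proof (rule ccontr)
  assume "\<not> 0 < overlap W"
  moreover have "0 \<le> overlap W"
    using has_sum_nonneg[OF has_sum_overlap[OF W]] W by simp
  ultimately have 0: "((\<lambda>y. min (W 0 y) (W 1 y)) has_sum 0) UNIV"
    using has_sum_overlap[OF W] by simp
  have "min (W 0 y) (W 1 y) = 0" for y
  proof -
    have "((\<lambda>y. min (W 0 y) (W 1 y)) has_sum min (W 0 y) (W 1 y)) {y}"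
      by (simp add: has_sum_finiteI)
    from has_sum_mono2[OF this 0] W show ?thesis by (simp add: order_antisym)
  qed
  then have "W 0 y * W 1 y = 0" for y by (metis min_def mult_zero_left mult_zero_right)
  then have "bhattacharyya W = 0"
    by (simp only: bhattacharyya_def real_sqrt_zero infsum_0_simp)
  then show False using info_ge_bhattacharyya[OF W] I by simp
qed

lemma has_sum_likelihood:
  assumes "channel W" "dim_vec c = N"
  shows "(likelihood W c has_sum 1) {ys. length ys = N}"
proof -
  have "((\<lambda>ys. \<Prod>i<N. W (c $ i) (ys ! i)) has_sum (\<Prod>i<N. 1)) {ys. length ys = N}"
    by (rule has_sum_prod_lists) (use assms in \<open>auto simp: channel_has_sum\<close>)
  then show ?thesis using assms by (simp add: likelihood_def[abs_def])
qed

lemma likelihood_nonneg: "channel W \<Longrightarrow> 0 \<le> likelihood W c ys"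
  by (simp add: likelihood_def prod_nonneg)

lemma block_error_le_1:
  assumes W: "channel W" and C: "C \<subseteq> carrier_vec N"
  shows "block_error W C N dec \<le> 1"
proof -
  have "block_error W C N dec \<le> (\<Sum>c\<in>C. 1 / card C * 1)"
    unfolding block_error_def
  proof (intro sum_mono mult_left_mono)
    fix c assume "c \<in> C"
    then have c: "(likelihood W c has_sum 1) {ys. length ys = N}"
      using C by (intro has_sum_likelihood W) auto
    have "likelihood W c summable_on {ys. length ys = N \<and> dec ys \<noteq> c}"
      by (rule summable_on_subset_banach[OF has_sum_imp_summable[OF c]]) auto
    from has_sum_mono2[OF has_sum_infsum[OF this] c]
    show "(\<Sum>\<^sub>\<infinity>ys\<in>{ys. length ys = N \<and> dec ys \<noteq> c}. likelihood W c ys) \<le> 1"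
      using likelihood_nonneg[OF W] by auto
  qed simp
  also have "\<dots> \<le> 1" by (cases "finite C \<and> C \<noteq> {}") auto
  finally show ?thesis .
qed

text \<open>For each output word at least one of c and c + v is decoded wrongly, so at least the
  smaller of their likelihoods is lost. Translation by v permutes the code, hence the average over c
  counts every error twice, which is the origin of the factor 1/2.\<close>

lemma block_error_lower_bound:
  assumes W: "channel W" and C: "finite C" "C \<noteq> {}" "C \<subseteq> carrier_vec N"
    and v: "v \<in> carrier_vec N" "0 < hamming_weight v" "\<And>c. c \<in> C \<Longrightarrow> c + v \<in> C"
  shows "overlap W ^ hamming_weight v / 2 \<le> block_error W C N dec"
proof -
  let ?Y = "{ys :: 'a list. length ys = N}"
  define E where "E c = (\<Sum>\<^sub>\<infinity>ys\<in>{ys. length ys = N \<and> dec ys \<noteq> c}. likelihood W c ys)" for c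
  have E: "((\<lambda>ys. of_bool (dec ys \<noteq> c) * likelihood W c ys) has_sum E c) ?Y" if "c \<in> C" for c
  proof -
    have c: "dim_vec c = N" using that C by auto
    have "(likelihood W c has_sum 1) ?Y" by (rule has_sum_likelihood[OF W c])
    then have "(likelihood W c) summable_on {ys. length ys = N \<and> dec ys \<noteq> c}"
      by (intro summable_on_subset_banach[OF has_sum_imp_summable]) auto
    then have "(likelihood W c has_sum E c) {ys. length ys = N \<and> dec ys \<noteq> c}"
      by (simp add: E_def)
    then show ?thesis
      by (rule has_sum_cong_neutral[THEN iffD1, rotated 3]) auto
  qed
  have pair: "overlap W ^ hamming_weight v \<le> E c + E (c + v)" if c: "c \<in> C" for c
  proof -
    have dims: "dim_vec c = N" "dim_vec v = N" using c C v by auto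
    \<comment> \<open>The product of these factors lies below both likelihoods, because c and c + v
      agree wherever v is 0.\<close>
    define m where "m i y = (if v $ i = 1 then min (W 0 y) (W 1 y) else W (c $ i) y)" for i y
    have "((\<lambda>ys. \<Prod>i<N. m i (ys ! i)) has_sum (\<Prod>i<N. if v $ i = 1 then overlap W else 1)) ?Y"
      by (rule has_sum_prod_lists) (use W in \<open>auto simp: m_def channel_has_sum has_sum_overlap\<close>)
    also have "(\<Prod>i<N. if v $ i = 1 then overlap W else 1) = (\<Prod>i\<in>{i \<in> {..<N}. v $ i = 1}. overlap W)"
      by (rule prod.inter_filter[symmetric]) simp
    also have "\<dots> = overlap W ^ hamming_weight v"
      by (simp add: hamming_weight_bit dims)
    finally have m: "((\<lambda>ys. \<Prod>i<N. m i (ys ! i)) has_sum overlap W ^ hamming_weight v) ?Y" .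
    have neq: "c \<noteq> c + v"
    proof
      assume eq: "c = c + v"
      have "v $ i = 0" if "i < N" for i
      proof -
        have "c $ i + v $ i = c $ i + 0"
          using arg_cong[OF eq, of "\<lambda>u. u $ i"] that dims by (simp only: index_add_vec add_0_right)
        then show ?thesis by (rule add_left_imp_eq)
      qed
      then have "{i. i < dim_vec v \<and> v $ i \<noteq> 0} = {}" using dims by auto
      then show False using v(2) unfolding hamming_weight_def by (simp only: card.empty)
    qed
    have m_nn: "0 \<le> m i y" for i y using W by (simp add: m_def)
    have min_le: "min (W 0 y) (W 1 y) \<le> W b y" for b y by (cases b) auto
    have le: "(\<Prod>i<N. m i (ys ! i)) \<le> likelihood W c ys" "(\<Prod>i<N. m i (ys ! i)) \<le> likelihood W (c + v) ys" for ys
      unfolding likelihood_def using m_nn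
      by (auto simp: dims m_def min_le intro!: prod_mono split: if_splits dest: bit.exhaust)
    have errors: "((\<lambda>ys. of_bool (dec ys \<noteq> c) * likelihood W c ys + of_bool (dec ys \<noteq> c + v) * likelihood W (c + v) ys)
        has_sum (E c + E (c + v))) ?Y"
      using c v by (intro has_sum_add E) auto
    show ?thesis
    proof (rule has_sum_mono[OF m errors])
      fix ys
      show "(\<Prod>i<N. m i (ys ! i)) \<le> of_bool (dec ys \<noteq> c) * likelihood W c ys
          + of_bool (dec ys \<noteq> c + v) * likelihood W (c + v) ys"
        using le[of ys] likelihood_nonneg[OF W, of c ys] likelihood_nonneg[OF W, of "c + v" ys] neq by (cases "dec ys = c") auto
    qed
  qed
  \<comment> \<open>Characteristic 2 makes translation by v an involution.\<close>
  have inv: "c + v + v = c" if "c \<in> C" for c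
  proof (rule eq_vecI)
    have dims: "dim_vec c = N" "dim_vec v = N" using that C v by auto
    then show "dim_vec (c + v + v) = dim_vec c" by simp
    fix i assume "i < dim_vec c"
    moreover have "v $ i + v $ i = 0" by (cases "v $ i") auto
    ultimately show "(c + v + v) $ i = c $ i"
      using dims by (simp only: index_add_vec add.assoc add_0_right)
  qed
  have "bij_betw (\<lambda>c. c + v) C C"
    by (rule bij_betw_byWitness[where f' = "\<lambda>c. c + v"]) (use inv v in auto)
  then have swap: "(\<Sum>c\<in>C. E (c + v)) = (\<Sum>c\<in>C. E c)"
    by (rule sum.reindex_bij_betw)
  have "card C * overlap W ^ hamming_weight v = (\<Sum>c\<in>C. overlap W ^ hamming_weight v)"
    by simp
  also have "\<dots> \<le> (\<Sum>c\<in>C. E c + E (c + v))" using pair by (intro sum_mono)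
  also have "\<dots> = 2 * (\<Sum>c\<in>C. E c)" by (simp add: sum.distrib swap)
  finally have "overlap W ^ hamming_weight v / 2 \<le> (\<Sum>c\<in>C. E c) / card C"
    using C by (simp add: field_simps card_gt_0_iff)
  also have "\<dots> = block_error W C N dec"
    by (simp add: block_error_def E_def sum_divide_distrib)
  finally show ?thesis .
qed

section \<open>Spans of binary vectors and row weights of Kronecker powers\<close>

lemma finite_carrier_vec_bit: "finite (carrier_vec n :: bit vec set)"
proof (rule finite_subset)
  show "carrier_vec n \<subseteq> vec_of_list ` {us :: bit list. length us = n}"
  proof
    fix v :: "bit vec" assume "v \<in> carrier_vec n"
    then show "v \<in> vec_of_list ` {us. length us = n}"
      by (intro image_eqI[of _ _ "list_of_vec v"]) (auto simp: vec_list)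
  qed
qed simp

lemma span_vec_props:
  fixes S :: "bit vec set"
  assumes S: "S \<subseteq> carrier_vec n"
  defines "C \<equiv> LinearCombinations.module.span class_ring (module_vec TYPE(bit) n) S"
  shows "finite C" "C \<subseteq> carrier_vec n" "S \<subseteq> C" "c \<in> C \<Longrightarrow> v \<in> S \<Longrightarrow> c + v \<in> C"
proof -
  interpret vec_space "TYPE(bit)" n .
  show C: "C \<subseteq> carrier_vec n" unfolding C_def using span_closed[OF S] by blast
  then show "finite C" using finite_carrier_vec_bit finite_subset by blast
  show "S \<subseteq> C" unfolding C_def using in_own_span[OF S] .
  then show "c + v \<in> C" if "c \<in> C" "v \<in> S"
    using that span_add1[OF S, of c v] unfolding C_def by auto
qed

context polarizing_kernel
begin

lemma dim_kronecker_power [simp]: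
  "dim_row (kronecker_power G n) = l ^ n" "dim_col (kronecker_power G n) = l ^ n"
  by (induction n) (auto simp: kronecker_def)

lemma hamming_weight_kronecker_power:
  "j < l ^ n \<Longrightarrow> hamming_weight (row (kronecker_power G n) j) = (\<Prod>d\<leftarrow>digits l n j. hamming_weight (row G d))"
proof (induction n arbitrary: j)
  case 0
  have "{i. i < 1 \<and> row (1\<^sub>m 1 :: bit mat) 0 $ i \<noteq> 0} = {0}" by auto
  then show ?case using 0 by (simp add: hamming_weight_def)
next
  case (Suc n)
  have "j mod l ^ n < l ^ n" using l_ge_2 by simp
  then show ?case
    using Suc.prems Suc.IH[of "j mod l ^ n"] unfolding kronecker_power.simps
    by (subst hamming_weight_kronecker) (auto simp: digits_Suc)
qed

text \<open>If row d were zero, the unit word at d and the zero word would have the same encoding.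
  Positive weights are what makes the logarithm of a product of weights additive.\<close>

lemma hamming_weight_row_pos:
  assumes "d < l"
  shows "0 < hamming_weight (row G d)"
proof (rule ccontr)
  assume "\<not> ?thesis"
  then have "{i. i < l \<and> G $$ (d, i) \<noteq> 0} = {}"
    using assms by (subst (asm) hamming_weight_def) (auto cong: conj_cong)
  then have G0: "G $$ (d, i) = 0" if "i < l" for i using that by blast
  let ?e = "(replicate l 0)[d := 1] :: bit list"
  have "?e = replicate l 0"
  proof (rule encode_inject)
    fix i assume "i < l"
    have "G $$ (k, i) * ?e ! k = 0" if "k < l" for k
      using that \<open>i < l\<close> G0 by (cases "k = d") auto
    then have "encode ?e i = 0" unfolding encode_def by (intro sum.neutral) simp
    then show "encode ?e i = encode (replicate l 0) i" by (simp add: encode_def)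
  qed auto
  then have "?e ! d = replicate l 0 ! d" by simp
  then show False using assms by simp
qed

lemma digits_in_words: "j < l ^ n \<Longrightarrow> digits l n j \<in> words n"
  using l_ge_2 by (auto simp: words_def digits_def)

lemma bij_betw_digits: "bij_betw (digits l n) {..<l ^ n} (words n)"
proof -
  have inj: "inj_on (digits l n) {..<l ^ n}"
  proof (induction n)
    case (Suc n)
    show ?case
    proof (rule inj_onI)
      fix i j assume ij: "i \<in> {..<l ^ Suc n}" "j \<in> {..<l ^ Suc n}" "digits l (Suc n) i = digits l (Suc n) j"
      then have "i div l ^ n = j div l ^ n" "digits l n (i mod l ^ n) = digits l n (j mod l ^ n)"
        by (auto simp: digits_Suc)
      moreover have "i mod l ^ n \<in> {..<l ^ n}" "j mod l ^ n \<in> {..<l ^ n}"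
        using l_ge_2 by auto
      ultimately have "i mod l ^ n = j mod l ^ n" using Suc by (auto dest: inj_onD)
      then show "i = j" using \<open>i div l ^ n = j div l ^ n\<close> by (metis div_mult_mod_eq)
    qed
  qed (auto simp: inj_on_def)
  have "digits l n ` {..<l ^ n} = words n"
    by (rule card_subset_eq) (auto simp: digits_in_words card_image[OF inj] card_words)
  with inj show ?thesis by (simp add: bij_betw_def)
qed

definition word_weight :: "nat list \<Rightarrow> real" where
  "word_weight ds = (\<Sum>d\<leftarrow>ds. log l (hamming_weight (row G d)))"

lemma log_hamming_weight:
  "set ds \<subseteq> {..<l} \<Longrightarrow> 0 < (\<Prod>d\<leftarrow>ds. hamming_weight (row G d)) \<and>
    log l (\<Prod>d\<leftarrow>ds. hamming_weight (row G d)) = word_weight ds"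
proof (induction ds)
  case (Cons d ds)
  define P where "P = (\<Prod>d\<leftarrow>ds. hamming_weight (row G d))"
  have "0 < P" "log l P = word_weight ds" "0 < hamming_weight (row G d)"
    using Cons hamming_weight_row_pos[of d] by (auto simp: P_def)
  then show ?case
    by (simp add: word_weight_def log_mult flip: P_def)
qed (simp add: word_weight_def)

text \<open>The generator chosen by i is the row with the reversed digits, but its weight is a
  product over digits and does not see their order; the digits of i itself determine it.\<close>

lemma block_error_polar_code:
  assumes W: "channel W" and i: "i \<in> I" "I \<subseteq> {..<l ^ n}"
  obtains w where "log l (real w) = word_weight (digits l n i)" "0 < w"
    "overlap W ^ w / 2 \<le> block_error W (polar_code G n I) (l ^ n) dec"
    "block_error W (polar_code G n I) (l ^ n) dec \<le> 1"
proof -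
  let ?S = "{row (kronecker_power G n) j | i j. i \<in> I \<and> j < dim_row G ^ n \<and>
          digits (dim_row G) n j = rev (digits (dim_row G) n i)}"
  have S: "?S \<subseteq> carrier_vec (l ^ n)" by (auto intro!: carrier_vecI)
  have il: "i < l ^ n" using i by auto
  have "rev (digits l n i) \<in> words n"
    using digits_in_words[OF il] by (simp add: words_def)
  then have "rev (digits l n i) \<in> digits l n ` {..<l ^ n}"
    unfolding bij_betw_imp_surj_on[OF bij_betw_digits] .
  then obtain j where j: "j < l ^ n" "digits l n j = rev (digits l n i)"
    by (metis imageE lessThan_iff)
  let ?v = "row (kronecker_power G n) j"
  have v: "?v \<in> ?S" using i j by auto
  have set: "set (digits l n i) \<subseteq> {..<l}" using digits_in_words[OF il] by (simp add: words_def)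
  have "hamming_weight ?v = (\<Prod>d\<leftarrow>digits l n i. hamming_weight (row G d))"
    unfolding hamming_weight_kronecker_power[OF j(1)] j(2)
    by (simp add: prod_list.rev flip: rev_map)
  then have w: "log l (real (hamming_weight ?v)) = word_weight (digits l n i)" "0 < hamming_weight ?v"
    using log_hamming_weight[OF set] by simp_all
  note C = span_vec_props[OF S]
  have "overlap W ^ hamming_weight ?v / 2 \<le> block_error W (polar_code G n I) (l ^ n) dec"
  proof (rule block_error_lower_bound[OF W])
    show "finite (polar_code G n I)" "polar_code G n I \<subseteq> carrier_vec (l ^ n)"
      using C(1,2) by (simp_all add: polar_code_def)
    show "polar_code G n I \<noteq> {}" using C(3) v by (auto simp: polar_code_def)
    show "?v \<in> carrier_vec (l ^ n)" using v S by blast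
    show "0 < hamming_weight ?v" by (fact w(2))
    show "c + ?v \<in> polar_code G n I" if "c \<in> polar_code G n I" for c
      using C(4) v that unfolding polar_code_def dim_row_G by blast
  qed
  moreover have "block_error W (polar_code G n I) (l ^ n) dec \<le> 1"
    using C(2) by (intro block_error_le_1 W) (simp add: polar_code_def)
  ultimately show thesis using w that by blast
qed

end

section \<open>Mutual information of the uniform input\<close>

lemma integral_count_space_has_sum:
  fixes f :: "'a \<Rightarrow> real"
  assumes "(f has_sum s) A"
  shows "(\<integral>x. f x \<partial>count_space A) = s"
proof -
  have "Infinite_Set_Sum.abs_summable_on f A"
    using has_sum_imp_summable[OF assms] summable_on_iff_abs_summable_on_real abs_summable_equivalent
    by blast
  from infsetsum_infsum[OF this] infsumI[OF assms] show ?thesis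
    by (simp add: infsetsum_def)
qed

lemma nn_integral_count_space_has_sum:
  fixes f :: "'a \<Rightarrow> real"
  assumes "(f has_sum s) A" "\<And>x. x \<in> A \<Longrightarrow> 0 \<le> f x"
  shows "(\<integral>\<^sup>+x. ennreal (f x) \<partial>count_space A) = ennreal s"
proof -
  have "Infinite_Set_Sum.abs_summable_on f A"
    using has_sum_imp_summable[OF assms(1)] summable_on_iff_abs_summable_on_real abs_summable_equivalent
    by blast
  from nn_integral_conv_infsetsum[OF this assms(2)] infsetsum_infsum[OF this] infsumI[OF assms(1)]
  show ?thesis by simp
qed

lemma has_sum_bit_pair:
  fixes g :: "bit \<times> 'a \<Rightarrow> real"
  assumes "((\<lambda>y. g (0, y)) has_sum a) UNIV" "((\<lambda>y. g (1, y)) has_sum b) UNIV"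
  shows "(g has_sum (a + b)) UNIV"
proof -
  have "(g has_sum a) (Pair 0 ` UNIV)" "(g has_sum b) (Pair 1 ` UNIV)"
    using assms by (auto simp: has_sum_reindex inj_on_def o_def)
  then have "(g has_sum (a + b)) (Pair 0 ` UNIV \<union> Pair 1 ` UNIV)"
    by (rule has_sum_Un_disjoint) auto
  also have "Pair 0 ` UNIV \<union> Pair 1 ` UNIV = (UNIV :: (bit \<times> 'a) set)"
    by (auto simp: image_iff)
  finally show ?thesis .
qed

text \<open>A single summand of \<open>pair_info\<close> may be negative, while the integral for the
  mutual information runs over pairs of input and output. Domination by \<open>a + b\<close> makes
  the summands absolutely summable for each input.\<close>

lemma pair_info_term_bounds:
  assumes "0 \<le> a" "0 \<le> b"
  shows "\<bar>a * log 2 (2 * a / (a + b))\<bar> \<le> a + b"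
proof (cases "a = 0")
  case False
  then have a: "0 < a" "0 < a + b" using assms by auto
  have "ln ((a + b) / (2 * a)) \<le> (a + b) / (2 * a) - 1"
    using a by (intro ln_le_minus_one) simp
  also have "\<dots> \<le> (a + b) / (2 * a)" by simp
  finally have "ln ((a + b) / (2 * a)) * (1 / ln 2) \<le> (a + b) / (2 * a) * (1 / ln 2)"
    by (intro mult_right_mono) auto
  also have "\<dots> \<le> (a + b) / (2 * a) * 2"
    using inverse_ln2_bounds a by (intro mult_left_mono) auto
  also have "\<dots> = (a + b) / a" using a by (simp add: field_simps)
  finally have "log 2 ((a + b) / (2 * a)) \<le> (a + b) / a" by (simp add: log_def)
  moreover have "log 2 ((a + b) / (2 * a)) = - log 2 (2 * a / (a + b))"
    using a by (simp add: log_divide)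
  ultimately have "a * - log 2 (2 * a / (a + b)) \<le> a * ((a + b) / a)"
    using a by (intro mult_left_mono) auto
  then have lower: "- (a + b) \<le> a * log 2 (2 * a / (a + b))" using a by simp
  have "log 2 (2 * a / (a + b)) \<le> log 2 2"
    using a assms by (intro log_mono) (auto simp: divide_simps)
  then have "a * log 2 (2 * a / (a + b)) \<le> a * 1" using a by (intro mult_left_mono) auto
  then show ?thesis using lower assms by simp
qed (use assms in simp)

text \<open>All densities refer to counting measures: 1/2 for the input,
  \<open>(W 0 y + W 1 y) / 2\<close> for the output, \<open>P\<close> for the pair. Countability of
  the output type makes the product of the counting measures a counting measure again.\<close>

lemma channel_information_eq_info:
  fixes W :: "'y::countable channel"
  assumes W: "channel W"
  shows "channel_information W = info W"
proof -
  define M where "M = uniform_joint W"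
  define P where "P z = (case z of (x, y) \<Rightarrow> W x y / 2)" for z
  have M: "M = density (count_space UNIV) (\<lambda>z. ennreal (P z))"
    unfolding M_def uniform_joint_def point_measure_def P_def by (simp add: case_prod_unfold)
  have space: "space M = UNIV" and sets: "sets M = UNIV" by (auto simp: M)
  have P_nn: "0 \<le> P z" for z using W by (auto simp: P_def split: prod.split)
  have em: "emeasure M A = ennreal s" if "(P has_sum s) A" for A s
  proof -
    have "emeasure M A = (\<integral>\<^sup>+z. ennreal (P z) * indicator A z \<partial>count_space UNIV)"
      unfolding M by (subst emeasure_density) auto
    also have "\<dots> = (\<integral>\<^sup>+z. ennreal (P z) \<partial>count_space A)"
      by (simp add: nn_integral_count_space_indicator)
    also have "\<dots> = ennreal s" using that P_nn by (intro nn_integral_count_space_has_sum)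
    finally show ?thesis .
  qed
  have Px: "((\<lambda>y. P (x, y)) has_sum 1 / 2) UNIV" for x
    using has_sum_cmult_left[OF channel_has_sum[OF W, of x], of "1 / 2"] by (simp add: P_def)
  have "emeasure M (space M) = 1"
    unfolding space using em[OF has_sum_bit_pair[OF Px Px]] by simp
  then interpret prob_space M by (rule prob_spaceI)
  interpret information_space M 2 by standard simp
  have meas: "X \<in> measurable M (count_space UNIV)" for X :: "bit \<times> 'y \<Rightarrow> 'b"
    by (simp add: measurable_def space sets)
  have countable_pair: "(count_space UNIV :: bit measure) \<Otimes>\<^sub>M (count_space UNIV :: 'y measure) = count_space UNIV"
    using pair_measure_countable[of "UNIV :: bit set" "UNIV :: 'y set"] countable_finite[OF finite_UNIV_bit]
    by simp
  have dx: "distributed M (count_space UNIV) fst (\<lambda>x. ennreal (1 / 2))"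
    unfolding distributed_def
  proof (intro conjI)
    show "distr M (count_space UNIV) fst = density (count_space UNIV) (\<lambda>x. ennreal (1 / 2))"
    proof (rule measure_eqI_countable[where A = UNIV])
      fix x :: bit
      have "(P has_sum 1 / 2) (Pair x ` UNIV)"
        using Px[of x] by (simp add: has_sum_reindex inj_on_def o_def)
      moreover have "fst -` {x} = Pair x ` (UNIV :: 'y set)" by auto
      ultimately show "emeasure (distr M (count_space UNIV) fst) {x}
          = emeasure (density (count_space UNIV) (\<lambda>x. ennreal (1 / 2))) {x}"
        by (subst emeasure_distr[OF meas]) (auto simp: space em emeasure_density)
    qed (auto intro: countable_finite finite_UNIV_bit)
  qed (auto intro: meas)
  have dy: "distributed M (count_space UNIV) snd (\<lambda>y. ennreal ((W 0 y + W 1 y) / 2))"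
    unfolding distributed_def
  proof (intro conjI)
    show "distr M (count_space UNIV) snd = density (count_space UNIV) (\<lambda>y. ennreal ((W 0 y + W 1 y) / 2))"
    proof (rule measure_eqI_countable[where A = UNIV])
      fix y :: 'y
      have "snd -` {y} = {(0, y), (1 :: bit, y)}" by auto
      moreover have "(P has_sum ((W 0 y + W 1 y) / 2)) {(0, y), (1, y)}"
        by (rule has_sum_finiteI) (auto simp: P_def add_divide_distrib)
      ultimately show "emeasure (distr M (count_space UNIV) snd) {y}
          = emeasure (density (count_space UNIV) (\<lambda>y. ennreal ((W 0 y + W 1 y) / 2))) {y}"
        by (subst emeasure_distr[OF meas]) (auto simp: space em emeasure_density)
    qed auto
  qed (auto intro: meas)
  have dxy: "distributed M (count_space UNIV \<Otimes>\<^sub>M count_space UNIV) (\<lambda>z. (fst z, snd z)) (\<lambda>z. ennreal (P z))"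
    unfolding distributed_def countable_pair
  proof (intro conjI)
    have "distr M (count_space UNIV) (\<lambda>z. z) = distr M M (\<lambda>z. z)"
      by (rule distr_cong) (auto simp: sets)
    then show "distr M (count_space UNIV) (\<lambda>z. (fst z, snd z)) = density (count_space UNIV) (\<lambda>z. ennreal (P z))"
      by (simp add: distr_id M[symmetric])
  qed (auto intro: meas)
  let ?f = "\<lambda>z. P z * log 2 (P z / (1 / 2 * ((W 0 (snd z) + W 1 (snd z)) / 2)))"
  have "channel_information W = (\<integral>z. ?f z \<partial>(count_space UNIV \<Otimes>\<^sub>M count_space UNIV))"
    unfolding channel_information_def M_def[symmetric]
    by (rule mutual_information_distr[OF _ _ dx _ dy _ dxy])
      (use W P_nn in \<open>auto intro: sigma_finite_measure_count_space_countable countable_finite finite_UNIV_bit\<close>)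
  also have "\<dots> = (\<integral>z. ?f z \<partial>count_space UNIV)" unfolding countable_pair ..
  also have "\<dots> = info W"
  proof (rule integral_count_space_has_sum)
    have f: "?f (x, y) = W x y * log 2 (2 * W x y / (W 0 y + W 1 y)) / 2" for x y
      by (simp add: P_def)
    have bound: "\<bar>?f (x, y)\<bar> \<le> W 0 y + W 1 y" for x y
    proof -
      have "\<bar>W x y * log 2 (2 * W x y / (W 0 y + W 1 y))\<bar> \<le> W 0 y + W 1 y"
        using pair_info_term_bounds[of "W 0 y" "W 1 y"] pair_info_term_bounds[of "W 1 y" "W 0 y"] W
        by (cases x) (simp_all add: add.commute)
      then show ?thesis unfolding f by simp
    qed
    have "(\<lambda>y. ?f (x, y)) summable_on UNIV" for x
    proof -
      have "(\<lambda>y. norm (?f (x, y))) summable_on UNIV"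
        by (rule summable_on_comparison_test[OF has_sum_imp_summable[OF channel_has_sum_add[OF W]]])
          (use bound in auto)
      then show ?thesis by (rule abs_summable_summable)
    qed
    then have s: "((\<lambda>y. ?f (x, y)) has_sum (\<Sum>\<^sub>\<infinity>y. ?f (x, y))) UNIV" for x by simp
    have "((\<lambda>y. ?f (0, y) + ?f (1, y)) has_sum ((\<Sum>\<^sub>\<infinity>y. ?f (0, y)) + (\<Sum>\<^sub>\<infinity>y. ?f (1, y)))) UNIV"
      by (rule has_sum_add[OF s s])
    moreover have "((\<lambda>y. ?f (0, y) + ?f (1, y)) has_sum info W) UNIV"
      using has_sum_cmult_left[OF has_sum_pair_info[OF W], of "1 / 2"]
      by (simp only: f) (simp add: pair_info_def add_divide_distrib)
    ultimately have "(\<Sum>\<^sub>\<infinity>y. ?f (0, y)) + (\<Sum>\<^sub>\<infinity>y. ?f (1, y)) = info W"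
      by (rule has_sum_unique)
    then show "(?f has_sum info W) UNIV" using has_sum_bit_pair[of ?f, OF s s] by simp
  qed
  finally show ?thesis .
qed

lemma has_sum_Raw:
  fixes F :: "'y symbol \<Rightarrow> real"
  assumes "((\<lambda>y. F (Raw y)) has_sum s) UNIV" "\<And>ys us. F (Split ys us) = 0"
  shows "(F has_sum s) UNIV"
proof -
  have "(F has_sum s) (range Raw)"
    using assms(1) by (simp add: has_sum_reindex inj_on_def o_def)
  then show ?thesis
  proof (rule has_sum_cong_neutral[THEN iffD1, rotated 3])
    show "F x = 0" if "x \<in> UNIV - range Raw" for x
      using that assms(2) by (cases x) auto
  qed auto
qed

lemma channel_raw_channel:
  assumes "channel W"
  shows "channel (raw_channel W)"
  unfolding channel_def
proof (intro conjI allI)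
  show "0 \<le> raw_channel W x y" for x y using assms by (cases y) auto
  show "(raw_channel W x has_sum 1) UNIV" for x
    using channel_has_sum[OF assms, of x] by (intro has_sum_Raw) auto
qed

lemma info_raw_channel:
  assumes "channel W"
  shows "info (raw_channel W) = info W"
proof -
  have "((\<lambda>y. pair_info (raw_channel W 0 y) (raw_channel W 1 y)) has_sum 2 * info W) UNIV"
    using has_sum_pair_info[OF assms] by (intro has_sum_Raw) (auto simp: pair_info_def)
  from has_sum_unique[OF this has_sum_pair_info[OF channel_raw_channel[OF assms]]]
  show ?thesis by simp
qed

section \<open>Row weights of the chosen indices\<close>

context polarizing_kernel
begin

sublocale uniform_digits l
  using l_ge_2 by unfold_locales simp

lemma polar_channel_eq_word_channel:
  "polar_channel G W n i = word_channel (raw_channel W) (digits l n i)"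
  by (simp add: polar_channel_def word_channel_def)

lemma word_weight_append: "word_weight (p @ r) = word_weight p + word_weight r"
  by (simp add: word_weight_def)

lemma E_w_eq: "E_w G = (\<Sum>d<l. log l (hamming_weight (row G d))) / l"
  by (simp add: E_w_def)

lemma V_w_eq: "V_w G = (\<Sum>d<l. (log l (hamming_weight (row G d)) - E_w G)\<^sup>2) / l"
  by (simp add: V_w_def)

lemma V_w_nonneg: "0 \<le> V_w G"
  unfolding V_w_eq by (intro divide_nonneg_nonneg sum_nonneg) auto

text \<open>Zero variance means that all rows of the kernel have the same logarithmic weight. This
  degenerate case is outside the central limit theorem.\<close>

lemma word_weight_V_w_0:
  assumes V: "V_w G = 0" and ds: "ds \<in> words n"
  shows "word_weight ds = n * E_w G"
proof -
  have "(\<Sum>d<l. (log l (hamming_weight (row G d)) - E_w G)\<^sup>2) = 0"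
    using V l_ge_2 by (simp add: V_w_eq)
  then have "\<forall>d\<in>{..<l}. (log l (hamming_weight (row G d)) - E_w G)\<^sup>2 = 0"
    by (subst (asm) sum_nonneg_eq_0_iff) auto
  then have d: "log l (hamming_weight (row G d)) = E_w G" if "d < l" for d
    using that by simp
  have "set ds \<subseteq> {..<l} \<Longrightarrow> word_weight ds = length ds * E_w G"
    by (induction ds) (auto simp: word_weight_def d algebra_simps)
  then show ?thesis using ds by (simp add: words_def)
qed

lemma proportion_heavy_tendsto:
  assumes "0 < V_w G"
  shows "(\<lambda>n. proportion n (\<lambda>ds. word_weight ds > n * E_w G + sqrt (n * V_w G) * t)) \<longlonglongrightarrow> Q t"
proof -
  have "{ds \<in> words n. word_weight ds > n * E_w G + sqrt (n * V_w G) * t}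
      = {ds. length ds = n \<and> set ds \<subseteq> {..<l} \<and> (\<Sum>d\<leftarrow>ds. log l (hamming_weight (row G d))) > n * E_w G + sqrt (n * V_w G) * t}" for n
    by (auto simp: words_def word_weight_def)
  then show ?thesis
    using central_limit_digits[of "\<lambda>d. log l (hamming_weight (row G d))" t, folded E_w_eq, folded V_w_eq] assms
    by (simp add: proportion_def)
qed

text \<open>A prefix of length m shifts the weight by a constant and, as sqrt (m + k) - sqrt k \<le>
  sqrt m, the threshold by another one. The gap between the thresholds for s and t grows like sqrt k
  and absorbs both.\<close>

lemma eventually_proportion_heavy_suffix:
  assumes V: "0 < V_w G" and st: "s < t" and b: "Q s < b" and p: "p \<in> words m"
  shows "\<forall>\<^sub>F k in sequentially. proportion k (\<lambda>r. word_weight (p @ r)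
    > length (p @ r) * E_w G + sqrt (length (p @ r) * V_w G) * t) \<le> b"
proof -
  let ?E = "E_w G" and ?v = "sqrt (V_w G)"
  have lp: "length p = m" using p by (simp add: words_def)
  have v: "0 < ?v" using V by simp
  have "filterlim (\<lambda>k. sqrt (real k)) at_top sequentially"
    by (rule filterlim_compose[OF sqrt_at_top filterlim_real_sequentially])
  \<comment> \<open>Multiplied by \<open>t - s\<close> and \<open>sqrt (V_w G)\<close>, this says
    that the gap exceeds the two effects of the prefix.\<close>
  then have "\<forall>\<^sub>F k in sequentially. (sqrt m * \<bar>t\<bar> + \<bar>m * ?E - word_weight p\<bar> / ?v) / (t - s) \<le> sqrt (real k)"
    by (simp add: filterlim_at_top)
  moreover have "\<forall>\<^sub>F k in sequentially. proportion k (\<lambda>r. word_weight r > k * ?E + sqrt (k * V_w G) * s) < b"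
    using order_tendstoD(2)[OF proportion_heavy_tendsto[OF V] b] .
  ultimately show ?thesis
  proof eventually_elim
    case (elim k)
    have "sqrt m * \<bar>t\<bar> + \<bar>m * ?E - word_weight p\<bar> / ?v \<le> sqrt (real k) * (t - s)"
      using elim(1) st by (simp add: pos_divide_le_eq)
    then have "?v * (sqrt m * \<bar>t\<bar> + \<bar>m * ?E - word_weight p\<bar> / ?v) \<le> ?v * (sqrt (real k) * (t - s))"
      using v by (intro mult_left_mono) auto
    then have 1: "?v * (sqrt m * \<bar>t\<bar>) + \<bar>m * ?E - word_weight p\<bar> \<le> ?v * (sqrt k * t) - ?v * (sqrt k * s)"
      using v by (simp add: algebra_simps)
    have "sqrt (real (m + k)) \<le> sqrt m + sqrt k"
      by (rule real_le_lsqrt) (auto simp: power2_sum)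
    then have "\<bar>sqrt (real (m + k)) - sqrt k\<bar> \<le> sqrt m" by simp
    then have "\<bar>(sqrt (real (m + k)) - sqrt k) * t\<bar> \<le> sqrt m * \<bar>t\<bar>"
      unfolding abs_mult by (intro mult_right_mono) auto
    then have "sqrt k * t - sqrt m * \<bar>t\<bar> \<le> sqrt (real (m + k)) * t"
      unfolding left_diff_distrib by linarith
    then have "?v * (sqrt k * t) - ?v * (sqrt m * \<bar>t\<bar>) \<le> ?v * (sqrt (real (m + k)) * t)"
      using v by (simp flip: right_diff_distrib)
    with 1 have key: "?v * (sqrt k * s) \<le> m * ?E - word_weight p + ?v * (sqrt (real (m + k)) * t)"
      by linarith
    have "proportion k (\<lambda>r. word_weight (p @ r) > length (p @ r) * ?E + sqrt (length (p @ r) * V_w G) * t)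
        \<le> proportion k (\<lambda>r. word_weight r > k * ?E + sqrt (k * V_w G) * s)"
      unfolding proportion_def
    proof (intro divide_right_mono of_nat_mono card_mono)
      show "{r \<in> words k. word_weight (p @ r) > length (p @ r) * ?E + sqrt (length (p @ r) * V_w G) * t}
          \<subseteq> {r \<in> words k. word_weight r > k * ?E + sqrt (k * V_w G) * s}"
      proof clarify
        fix r assume r: "r \<in> words k" and h: "word_weight (p @ r) > length (p @ r) * ?E + sqrt (length (p @ r) * V_w G) * t"
        have len: "length (p @ r) = m + k" using r lp by (simp add: words_def)
        have "word_weight p + word_weight r > (m + k) * ?E + sqrt ((m + k) * V_w G) * t"
          using h unfolding len word_weight_append .
        then show "word_weight r > k * ?E + sqrt (k * V_w G) * s"
          using key unfolding real_sqrt_mult by (simp add: algebra_simps)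
      qed
    qed auto
    then show ?case using elim(2) by simp
  qed
qed

lemma eventually_pow_l_ge: "\<forall>\<^sub>F n in sequentially. K \<le> real l ^ n"
proof -
  have l: "1 < real l" using l_ge_2 by simp
  then obtain N where "K < real l ^ N" using real_arch_pow by blast
  then show ?thesis
    using power_increasing[of N _ "real l"] l
    by (intro eventually_sequentiallyI[of N]) (force intro: less_imp_le order_less_le_trans)
qed

text \<open>There are more channels of information at least 1 - \<kappa> than chosen indices. If an
  unreliable channel were chosen, all of these better ones would have to be chosen as well, which is
  too many.\<close>

lemma eventually_chosen_reliable:
  fixes W :: "'y channel"
  assumes W: "channel W" and R: "R < info W" and I: "\<And>n. polar_index_set G W R n (I n)"
  shows "\<forall>\<^sub>F n in sequentially. \<forall>i\<in>I n. bhattacharyya (word_channel (raw_channel W) (digits l n i)) \<le> 1 / 4"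
proof -
  let ?W = "raw_channel W"
  let ?C = "\<lambda>n i. word_channel ?W (digits l n i)"
  note rW = channel_raw_channel[OF W] and iW = info_raw_channel[OF W]
  \<comment> \<open>The bound 1/32 fits t = 1/16 in \<open>bhattacharyya_le_info\<close>: 1/8 + 4
    \<kappa> \<le> 1/4. The other bound leaves a surplus of \<kappa> l^n good channels over R l^n,
    enough for the rounding in the number of chosen indices.\<close>
  define \<kappa> where "\<kappa> = min (1 / 32) ((info W - R) / 4)"
  have \<kappa>: "0 < \<kappa>" "\<kappa> \<le> 1 / 32" "4 * \<kappa> \<le> info W - R"
    using R min.cobounded2[of "1 / 32" "(info W - R) / 4"] by (auto simp: \<kappa>_def simp del: min.cobounded2)
  have "\<forall>\<^sub>F n in sequentially. proportion n (\<lambda>ds. \<kappa> < info (word_channel ?W ds) \<and> info (word_channel ?W ds) < 1 - \<kappa>) < \<kappa>"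
    using order_tendstoD(2)[OF polarization[OF rW \<kappa>(1)] \<kappa>(1)] .
  moreover have "\<forall>\<^sub>F n in sequentially. 1 / \<kappa> \<le> real l ^ n"
    by (rule eventually_pow_l_ge)
  ultimately show ?thesis
  proof eventually_elim
    case (elim n)
    have sub: "I n \<subseteq> {..<l ^ n}" and cardI: "\<bar>real (card (I n)) - real (l ^ n) * R\<bar> < 1"
      and best: "\<And>i k. i \<in> I n \<Longrightarrow> k \<in> {..<l ^ n} - I n \<Longrightarrow> bhattacharyya (?C n i) \<le> bhattacharyya (?C n k)"
      using I[of n] by (auto simp: polar_index_set_def polar_channel_eq_word_channel)
    define A where "A = {k \<in> {..<l ^ n}. 1 - \<kappa> \<le> info (?C n k)}"
    have "bij_betw (digits l n) A {ds \<in> words n. 1 - \<kappa> \<le> info (word_channel ?W ds)}"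
      using bij_betw_digits[of n] by (auto simp: bij_betw_def A_def intro: inj_on_subset)
    then have cardA: "card A = proportion n (\<lambda>ds. 1 - \<kappa> \<le> info (word_channel ?W ds)) * l ^ n"
      using l_ge_2 by (simp add: proportion_def bij_betw_same_card)
    have pos: "0 < real l ^ n" using l_ge_2 by simp
    have "R + \<kappa> \<le> proportion n (\<lambda>ds. 1 - \<kappa> \<le> info (word_channel ?W ds))"
      using proportion_good_ge[OF rW \<kappa>(1), of n] elim(1) \<kappa> iW by linarith
    then have "(R + \<kappa>) * l ^ n \<le> card A"
      unfolding cardA using pos by (intro mult_right_mono) auto
    moreover have "1 \<le> \<kappa> * l ^ n" using elim(2) \<kappa> by (simp add: field_simps)
    ultimately have "real (card (I n)) < card A"
      using cardI by (simp add: algebra_simps)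
    then have less: "card (I n) < card A" by simp
    show ?case
    proof (rule ccontr)
      assume "\<not> ?thesis"
      then obtain i where i: "i \<in> I n" "1 / 4 < bhattacharyya (?C n i)" by force
      have "A \<subseteq> I n"
      proof
        fix k assume k: "k \<in> A"
        then have "k < l ^ n" by (simp add: A_def)
        from digits_in_words[OF this] have c: "channel (?C n k)" by (rule channel_word_channel'[OF rW])
        have "bhattacharyya (?C n k) \<le> 2 * (1 / 16) + (1 - info (?C n k)) / (4 * (1 / 16))"
          by (rule bhattacharyya_le_info[OF c]) simp
        then have "bhattacharyya (?C n k) \<le> 1 / 4" using k \<kappa> by (simp add: A_def)
        then show "k \<in> I n" using best[OF i(1), of k] i(2) \<open>k < l ^ n\<close> by force
      qed
      then have "card A \<le> card (I n)"
        using finite_subset[OF sub] by (intro card_mono) auto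
      then show False using less by simp
    qed
  qed
qed

text \<open>Otherwise all chosen indices would be reliable and heavy at once. By asymptotic
  independence the proportion of such indices is close to at most \<open>info W * Q t\<close>, which
  is less than R.\<close>

lemma eventually_light_row:
  fixes W :: "'y channel"
  assumes W: "channel W" and R: "0 < R" "R < info W" and I: "\<And>n. polar_index_set G W R n (I n)"
    and t: "Q t < R / info W"
  shows "\<forall>\<^sub>F n in sequentially. \<exists>i\<in>I n. word_weight (digits l n i) \<le> n * E_w G + sqrt (n * V_w G) * t"
proof (cases "V_w G = 0")
  case True
  have "\<forall>\<^sub>F n in sequentially. 1 / R \<le> real l ^ n" by (rule eventually_pow_l_ge)
  then show ?thesis
  proof eventually_elim
    case (elim n)
    have sub: "I n \<subseteq> {..<l ^ n}" and cardI: "\<bar>real (card (I n)) - real (l ^ n) * R\<bar> < 1"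
      using I[of n] by (auto simp: polar_index_set_def)
    have "1 \<le> real (l ^ n) * R" using elim R by (simp add: field_simps)
    then have "I n \<noteq> {}" using cardI by auto
    then obtain i where i: "i \<in> I n" by blast
    then have "word_weight (digits l n i) = n * E_w G"
      using sub digits_in_words[of i n] by (intro word_weight_V_w_0[OF True]) auto
    then show ?case using True by (intro bexI[OF _ i]) simp
  qed
next
  case False
  then have V: "0 < V_w G" using V_w_nonneg by simp
  let ?W = "raw_channel W"
  let ?C = "\<lambda>n i. word_channel ?W (digits l n i)"
  note rW = channel_raw_channel[OF W] and iW = info_raw_channel[OF W]
  define B where "B ds \<longleftrightarrow> word_weight ds > length ds * E_w G + sqrt (length ds * V_w G) * t" for ds
  have J: "0 < info W" using R by simp
  \<comment> \<open>A slightly smaller s provides the gap for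
    \<open>eventually_proportion_heavy_suffix\<close>, while \<open>Q s\<close> stays below
    \<open>R / info W\<close>.\<close>
  have "isCont Q t"
    unfolding Q_eq_cdf[abs_def] by (intro continuous_intros isCont_cdf_std_normal)
  then have "\<forall>\<^sub>F s in at_left t. Q s < R / info W"
    using t by (intro order_tendstoD(2)[of Q "Q t"]) (auto simp: isCont_def intro: tendsto_within_subset)
  moreover have "\<forall>\<^sub>F s in at_left t. s < t"
    by (simp add: eventually_at_left_field) (meson lt_ex)
  ultimately have "\<forall>\<^sub>F s in at_left t. s < t \<and> Q s < R / info W"
    by eventually_elim auto
  from eventually_happens'[OF _ this] obtain s where s: "s < t" "Q s < R / info W"
    by auto
  then have JQ: "info W * Q s < R" using J by (simp add: field_simps)
  \<comment> \<open>With half of the gap the proportion is at most R - \<epsilon>; the missing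
    \<epsilon> l^n indices, eventually at least one, exceed the rounding error.\<close>
  define \<epsilon> where "\<epsilon> = (R - info W * Q s) / 2"
  have \<epsilon>: "0 < \<epsilon>" using JQ by (simp add: \<epsilon>_def)
  have "\<forall>\<^sub>F n in sequentially. proportion n (\<lambda>ds. bhattacharyya (word_channel ?W ds) \<le> 1 / 4 \<and> B ds) \<le> info ?W * Q s + \<epsilon>"
  proof (rule eventually_proportion_good_and_le[OF rW Q_nonneg \<epsilon>])
    show "\<forall>\<^sub>F k in sequentially. proportion k (\<lambda>r. B (p @ r)) \<le> b" if "p \<in> words m" "Q s < b" for m p b
      unfolding B_def by (rule eventually_proportion_heavy_suffix[OF V s(1) that(2,1)])
  qed
  moreover have "\<forall>\<^sub>F n in sequentially. 1 / \<epsilon> \<le> real l ^ n" by (rule eventually_pow_l_ge)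
  moreover note eventually_chosen_reliable[OF W R(2) I]
  ultimately show ?thesis
  proof eventually_elim
    case (elim n)
    have sub: "I n \<subseteq> {..<l ^ n}" and cardI: "\<bar>real (card (I n)) - real (l ^ n) * R\<bar> < 1"
      using I[of n] by (auto simp: polar_index_set_def)
    have pos: "0 < real l ^ n" using l_ge_2 by simp
    show ?case
    proof (rule ccontr)
      assume "\<not> ?thesis"
      then have heavy: "B (digits l n i)" if "i \<in> I n" for i
        using that sub digits_in_words[of i n] by (force simp: B_def words_def)
      have "card (I n) = card (digits l n ` I n)"
        using bij_betw_digits[of n] sub by (intro card_image[symmetric]) (auto simp: bij_betw_def intro: inj_on_subset)
      also have "\<dots> \<le> card {ds \<in> words n. bhattacharyya (word_channel ?W ds) \<le> 1 / 4 \<and> B ds}"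
        using heavy elim(3) sub by (intro card_mono) (auto intro: digits_in_words)
      also have "\<dots> = proportion n (\<lambda>ds. bhattacharyya (word_channel ?W ds) \<le> 1 / 4 \<and> B ds) * l ^ n"
        using l_ge_2 by (simp add: proportion_def)
      also have "\<dots> \<le> (info W * Q s + \<epsilon>) * l ^ n"
        using elim(1) iW pos by (intro mult_right_mono) auto
      also have "\<dots> = (R - \<epsilon>) * l ^ n" by (simp add: \<epsilon>_def field_simps)
      also have "\<dots> \<le> R * l ^ n - 1"
        using elim(2) \<epsilon> by (simp add: field_simps)
      finally show False using cardI by (simp add: mult.commute)
    qed
  qed
qed

text \<open>The factor 1/2 adds 1 to the first logarithm, which is at most w and so is absorbed into
  \<open>w * (1 - log 2 \<beta>)\<close>. The second logarithm makes the constant factor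
  additive.\<close>

lemma log_neg_log_block_error_le:
  assumes \<beta>: "0 < \<beta>" "\<beta> \<le> 1" and w: "0 < w" and P: "\<beta> ^ w / 2 \<le> P" "P \<le> 1"
  shows "0 < P" "log l (- log 2 P) \<le> log l (real w) + log l (1 - log 2 \<beta>)"
proof -
  show "0 < P" using P \<beta> by (smt (verit) half_gt_zero zero_less_power)
  have l: "1 < real l" using l_ge_2 by simp
  have log\<beta>: "log 2 \<beta> \<le> 0" using \<beta> by (simp add: log_le_zero_cancel_iff)
  have "log 2 (\<beta> ^ w / 2) \<le> log 2 P" using P \<beta> \<open>0 < P\<close> by (intro log_mono) auto
  then have "- log 2 P \<le> 1 - w * log 2 \<beta>" using \<beta> by (simp add: log_divide log_nat_power)
  also have "\<dots> \<le> w * (1 - log 2 \<beta>)" using w by (simp add: algebra_simps)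
  finally have le: "- log 2 P \<le> w * (1 - log 2 \<beta>)" .
  have "log l (- log 2 P) \<le> log l (w * (1 - log 2 \<beta>))"
  proof (cases "P = 1")
    case True \<comment> \<open>the left-hand side is \<open>log l 0 = 0\<close>\<close>
    have "1 * 1 \<le> w * (1 - log 2 \<beta>)" using w log\<beta> by (intro mult_mono) auto
    then show ?thesis using True l by (simp add: log_def[of _ 0]) 
  next
    case False
    then have "0 < - log 2 P" using P \<open>0 < P\<close> by (simp add: log_less_zero_cancel_iff)
    then show ?thesis using le l by (intro log_mono) auto
  qed
  also have "\<dots> = log l (real w) + log l (1 - log 2 \<beta>)"
    using w log\<beta> by (simp add: log_mult)
  finally show "log l (- log 2 P) \<le> log l (real w) + log l (1 - log 2 \<beta>)" .
qed

end

theorem theorem4: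
  fixes W :: "'y::countable channel" and G :: "bit mat" and l :: nat and R :: real
    and I :: "nat \<Rightarrow> nat set" and dec :: "nat \<Rightarrow> 'y list \<Rightarrow> bit vec"
  assumes "bms_channel W"
    and "polarizing l G"
    and "0 < R" and "R < channel_information W"
    and "channel_information W < 1"
    and "\<And>n. polar_index_set G W R n (I n)"
    and "\<And>n. map_decoder W (polar_code G n (I n)) (l ^ n) (dec n)"
  shows "\<exists>\<epsilon>. \<epsilon> \<in> o(\<lambda>n. sqrt (real n)) \<and>
    (\<forall>\<^sub>F n in sequentially.
       let P_MAP = block_error W (polar_code G n (I n)) (l ^ n) (dec n) in
       0 < P_MAP \<and>
       log l (- log 2 P_MAP) \<le>
         real n * E_w G + sqrt (real n * V_w G) * inv_into UNIV Q (R / channel_information W) + \<epsilon> n)"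
proof -
  interpret polarizing_kernel G l by standard fact
  have W: "channel W" using assms(1) by (simp add: bms_channel_def channel_def)
  note J = channel_information_eq_info[OF W]
  define \<tau> where "\<tau> = inv_into UNIV Q (R / channel_information W)"
  define P where "P n = block_error W (polar_code G n (I n)) (l ^ n) (dec n)" for n
  define K where "K = log l (1 - log 2 (overlap W))"
  \<comment> \<open>As the positive part of the excess over the main terms, \<epsilon> satisfies the
    inequality by definition; the content is its growth.\<close>
  define \<epsilon> where "\<epsilon> n = max 0 (log l (- log 2 (P n)) - (real n * E_w G + sqrt (real n * V_w G) * \<tau>))" for n
  have \<tau>: "Q \<tau> = R / info W"
    unfolding \<tau>_def J using assms by (intro Q_inv_into) (simp_all add: J)
  \<comment> \<open>The constant \<open>K\<close> is the same for all t; only the n from which the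
    bound holds depends on t.\<close>
  have main: "\<forall>\<^sub>F n in sequentially. 0 < P n \<and> log l (- log 2 (P n)) \<le> n * E_w G + sqrt (n * V_w G) * t + K"
    if "\<tau> < t" for t
  proof -
    have "Q t < R / info W" using Q_strict_antimono[OF that] \<tau> by simp
    from eventually_light_row[OF W assms(3) assms(4)[unfolded J] assms(6) this] show ?thesis
    proof eventually_elim
      case (elim n)
      then obtain i where i: "i \<in> I n" "word_weight (digits l n i) \<le> n * E_w G + sqrt (n * V_w G) * t" by blast
      have "I n \<subseteq> {..<l ^ n}" using assms(6)[of n] by (simp add: polar_index_set_def)
      from block_error_polar_code[OF W i(1) this, of "dec n"] obtain w
        where w: "log l (real w) = word_weight (digits l n i)" "0 < w" "overlap W ^ w / 2 \<le> P n" "P n \<le> 1"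
        unfolding P_def by blast
      have "0 < overlap W" using overlap_pos[OF W] assms(5) J by simp
      from log_neg_log_block_error_le[OF this overlap_le_1[OF W] w(2-4)] w(1) i(2)
      show ?case by (simp add: K_def)
    qed
  qed
  have "\<epsilon> \<in> o(\<lambda>n. sqrt (real n))"
  proof (rule landau_o.smallI)
    fix c :: real assume c: "0 < c"
    let ?v = "sqrt (V_w G)"
    \<comment> \<open>Half of c pays for \<delta>, the other half for \<open>K\<close>; the summand
      1 prevents division by 0 when the variance vanishes.\<close>
    define \<delta> where "\<delta> = c / (2 * (?v + 1))"
    have v: "0 \<le> ?v" using V_w_nonneg by simp
    then have \<delta>: "0 < \<delta>" using c
    by (auto simp: \<delta>_def intro!: divide_pos_pos mult_pos_pos add_nonneg_pos)
    have "x * (c / (2 * (x + 1))) \<le> c / 2" if "0 \<le> x" for x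
      using that c by (simp add: field_simps)
    from this[OF v] have v\<delta>: "?v * \<delta> \<le> c / 2" by (simp add: \<delta>_def)
    have "filterlim (\<lambda>n. sqrt (real n)) at_top sequentially"
      by (rule filterlim_compose[OF sqrt_at_top filterlim_real_sequentially])
    then have "\<forall>\<^sub>F n in sequentially. K / (c / 2) \<le> sqrt (real n)"
      by (simp add: filterlim_at_top)
    moreover have "\<forall>\<^sub>F n in sequentially. 0 < P n \<and> log l (- log 2 (P n)) \<le> n * E_w G + sqrt (n * V_w G) * (\<tau> + \<delta>) + K"
      using main \<delta> by simp
    ultimately show "\<forall>\<^sub>F n in sequentially. norm (\<epsilon> n) \<le> c * norm (sqrt (real n))"
    proof eventually_elim
      case (elim n)
      have "K \<le> c / 2 * sqrt n" using elim(1) c by (simp add: pos_divide_le_eq mult_ac)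
      moreover have "sqrt n * (?v * \<delta>) \<le> sqrt n * (c / 2)" using v\<delta> by (intro mult_left_mono) auto
      moreover have "log l (- log 2 (P n)) - (n * E_w G + sqrt (n * V_w G) * \<tau>) \<le> sqrt n * (?v * \<delta>) + K"
        using elim(2) by (simp add: real_sqrt_mult algebra_simps)
      ultimately have "log l (- log 2 (P n)) - (n * E_w G + sqrt (n * V_w G) * \<tau>) \<le> c * sqrt n"
        by (simp add: mult.commute)
      then show ?case using c by (simp add: \<epsilon>_def)
    qed
  qed
  \<comment> \<open>Only positivity of \<open>P n\<close> is taken from \<open>main\<close> here, so
    any t above \<tau> serves.\<close>
  moreover have "\<forall>\<^sub>F n in sequentially. 0 < P n \<and> log l (- log 2 (P n)) \<le> real n * E_w G + sqrt (real n * V_w G) * \<tau> + \<epsilon> n"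
    using main[of "\<tau> + 1"] by (rule eventually_mono) (auto simp: \<epsilon>_def)
  ultimately show ?thesis
    unfolding P_def \<tau>_def Let_def by blast
qed

end
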